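(* Let $X$ be a Banach space and consider $u'(t)=F(u(t))=Au(t)+g(u(t))$, $u(t_0)=u_0$. Assume that: (i) the linear operator $A$ is the generator of a strongly continuous semigroup $e^{tA}$ in $X$; (ii) the problem possesses a sufficiently smooth solution $u:[0,T]\to X$ with derivatives in $X$, the nonlinearity $g:X\to X$ is sufficiently often Fréchet differentiable in a strip along the exact solution, and all occurring derivatives are uniformly bounded; (iii) $A$ and $g$ are such that, with $\tilde u_n=u(t_n)$, $\tilde u_n'=u'(t_n)$, $\tilde u_n''=u''(t_n)$, the expression $$A\big(g^{(3)}(\tilde u_n)(\tilde u_n',\tilde u_n',\tilde u_n')+3g''(\tilde u_n)(\tilde u_n',\tilde u_n'')\big)$$ is uniformly bounded on $X$. Then a 2-stage explicit exponential Rosenbrock method with node $c_2$ and coefficient $b_2$ (as defined in the context) has order of consistency five, i.e. the local error satisfies $\tilde e_{n+1}=\mathcal{O}(h^5)$, if the following order conditions are fulfilled: $$b_2(Z)c_2^2=2\varphi_3(Z),\qquad b_2(0)c_2^3=6\varphi_4(0),$$ where $Z$ denotes an arbitrary square matrix. Moreover, the remainder term of $\tilde e_{n+1}$ hidden behind the Landau notation is bounded by $Ch^5$ with a constant $C$ that only depends on values that are uniformly bounded by the assumptions made, i.e. is independent of $n$ and $h$.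
   Context: Functions $\varphi_k$: $\varphi_0(z)=e^z$ and $\varphi_k(z)=\int_0^1 e^{(1-\theta)z}\frac{\theta^{k-1}}{(k-1)!}\,d\theta$ for $k\ge1$. For the generator $J$ of a strongly continuous semigroup, $\varphi_k(hJ)$ is the bounded operator obtained by replacing $e^{(1-\theta)z}$ by the semigroup $e^{(1-\theta)hJ}$. The coefficient $b_2(z)$ is a linear combination of functions $\varphi_k(z)$. Under (i) and (ii) the Jacobian $J(u)=\frac{\partial F}{\partial u}(u)=A+g'(u)$ also generates a strongly continuous semigroup. 2-stage explicit exponential Rosenbrock method with node $c_2$ and coefficient $b_2$, step size $h>0$, $t_n=t_0+nh$, $u_n\approx u(t_n)$: with $J_n=A+g'(u_n)$ and $g_n(u)=F(u)-J_nu=g(u)-g'(u_n)u$, $$U_{n2}=u_n+c_2h\varphi_1(c_2hJ_n)F(u_n),\qquad u_{n+1}=u_n+h\varphi_1(hJ_n)F(u_n)+h\,b_2(hJ_n)\big(g_n(U_{n2})-g_n(u_n)\big).$$ Local error: let $\tilde u_n=u(t_n)$ be the exact solution, $\tilde J_n=A+g'(\tilde u_n)$, $\tilde g_n(u)=F(u)-\tilde J_nu=g(u)-g'(\tilde u_n)u$. One step of the method starting from the exact value $\tilde u_n$ gives $$\bar U_{n2}=\tilde u_n+c_2h\varphi_1(c_2h\tilde J_n)F(\tilde u_n),\qquad \bar u_{n+1}=\tilde u_n+h\varphi_1(h\tilde J_n)F(\tilde u_n)+h\,b_2(h\tilde J_n)\big(\tilde g_n(\bar U_{n2})-\tilde g_n(\tilde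 u_n)\big),$$ and the local error is $\tilde e_{n+1}=\bar u_{n+1}-u(t_{n+1})$. *)

theory Defs
  imports "HOL-Analysis.Analysis" "Jordan_Normal_Form.Matrix"
begin

section \<open>Strongly continuous semigroups and their generators\<close>

definition c0_semigroup :: "(real \<Rightarrow> 'a::banach \<Rightarrow>\<^sub>L 'a) \<Rightarrow> bool" where
  "c0_semigroup S \<longleftrightarrow>
     S 0 = id_blinfun \<and>
     (\<forall>s\<ge>0. \<forall>t\<ge>0. S (s + t) = S s o\<^sub>L S t) \<and>
     (\<forall>x. ((\<lambda>t. blinfun_apply (S t) x) \<longlongrightarrow> x) (at_right 0))"

text \<open>An unbounded operator is given by its domain \<open>D\<close> and a function \<open>A\<close>
  whose values outside \<open>D\<close> are irrelevant. The domain of the generator is exactly the set of all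
  \<open>x\<close> for which the difference quotients converge.\<close>

definition generates :: "'a::banach set \<Rightarrow> ('a \<Rightarrow> 'a) \<Rightarrow> (real \<Rightarrow> 'a \<Rightarrow>\<^sub>L 'a) \<Rightarrow> bool" where
  "generates D A S \<longleftrightarrow>
     c0_semigroup S \<and>
     (\<forall>x y. (x \<in> D \<and> A x = y) \<longleftrightarrow>
        ((\<lambda>h. (1 / h) *\<^sub>R (blinfun_apply (S h) x - x)) \<longlongrightarrow> y) (at_right 0))"

definition is_generator :: "'a::banach set \<Rightarrow> ('a \<Rightarrow> 'a) \<Rightarrow> bool" where
  "is_generator D A \<longleftrightarrow> (\<exists>S. generates D A S)"

text \<open>\<open>semigroup_of D A t\<close> is \<open>e\<^sup>t\<^sup>A\<close>. A generator determines its semigroup for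
  \<open>t \<ge> 0\<close>; the values at negative times, which \<open>c0_semigroup\<close> leaves open, are the
  reason for using \<open>SOME\<close> rather than \<open>THE\<close>.\<close>

definition semigroup_of :: "'a::banach set \<Rightarrow> ('a \<Rightarrow> 'a) \<Rightarrow> real \<Rightarrow> 'a \<Rightarrow>\<^sub>L 'a" where
  "semigroup_of D A = (SOME S. generates D A S)"


section \<open>The functions \<open>\<phi>\<^sub>k\<close> of scalars, matrices and generators\<close>

fun phi :: "nat \<Rightarrow> 'a \<Rightarrow> 'a::{real_normed_algebra_1,banach}" where
  "phi 0 z = exp z"
| "phi (Suc k) z = integral {0..1} (\<lambda>\<theta>::real. (\<theta> ^ k / fact k) *\<^sub>R exp ((1 - \<theta>) *\<^sub>R z))"

text \<open>The type of matrices of varying size is not a normed space, so the exponential series, the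
  integrals and the linear combinations are taken entrywise.\<close>

definition exp_mat :: "real mat \<Rightarrow> real mat" where
  "exp_mat Z = mat (dim_row Z) (dim_row Z) (\<lambda>(i, j). \<Sum>l. (Z ^\<^sub>m l) $$ (i, j) / fact l)"

fun phi_mat :: "nat \<Rightarrow> real mat \<Rightarrow> real mat" where
  "phi_mat 0 Z = exp_mat Z"
| "phi_mat (Suc k) Z = mat (dim_row Z) (dim_row Z)
     (\<lambda>(i, j). integral {0..1}
        (\<lambda>\<theta>::real. (\<theta> ^ k / fact k) * exp_mat ((1 - \<theta>) \<cdot>\<^sub>m Z) $$ (i, j)))"

text \<open>\<open>phi_op k D J h x\<close> is \<open>\<phi>\<^sub>k(hJ) x\<close>. The integral is a strong one, i.e. it is taken
  after application to \<open>x\<close>, as the semigroup need not be continuous in operator norm.\<close>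

fun phi_op :: "nat \<Rightarrow> 'a::banach set \<Rightarrow> ('a \<Rightarrow> 'a) \<Rightarrow> real \<Rightarrow> 'a \<Rightarrow> 'a" where
  "phi_op 0 D J h x = blinfun_apply (semigroup_of D J h) x"
| "phi_op (Suc k) D J h x = integral {0..1}
     (\<lambda>\<theta>::real. (\<theta> ^ k / fact k) *\<^sub>R blinfun_apply (semigroup_of D J ((1 - \<theta>) * h)) x)"

text \<open>The linear combination \<open>\<Sum>k\<le>m. \<beta> k \<cdot> \<phi>\<^sub>k\<close>, evaluated at a scalar, at a matrix, and
  at \<open>hJ\<close>.\<close>

definition phi_comb :: "nat \<Rightarrow> (nat \<Rightarrow> real) \<Rightarrow> 'a \<Rightarrow> 'a::{real_normed_algebra_1,banach}" where
  "phi_comb m \<beta> z = (\<Sum>k\<le>m. \<beta> k *\<^sub>R phi k z)"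

definition phi_comb_mat :: "nat \<Rightarrow> (nat \<Rightarrow> real) \<Rightarrow> real mat \<Rightarrow> real mat" where
  "phi_comb_mat m \<beta> Z = mat (dim_row Z) (dim_row Z)
     (\<lambda>(i, j). \<Sum>k\<le>m. \<beta> k * phi_mat k Z $$ (i, j))"

definition phi_comb_op ::
  "nat \<Rightarrow> (nat \<Rightarrow> real) \<Rightarrow> 'a::banach set \<Rightarrow> ('a \<Rightarrow> 'a) \<Rightarrow> real \<Rightarrow> 'a \<Rightarrow> 'a" where
  "phi_comb_op m \<beta> D J h x = (\<Sum>k\<le>m. \<beta> k *\<^sub>R phi_op k D J h x)"


section \<open>The two-stage explicit exponential Rosenbrock method\<close>

text \<open>In this section \<open>g1\<close> is the Frechet derivative of \<open>g\<close>, and \<open>v\<close> is the value at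
  which the equation is linearised (\<open>u\<^sub>n\<close> for the method, \<open>u(t\<^sub>n)\<close> for the local error).\<close>

definition rhs :: "('a::banach \<Rightarrow> 'a) \<Rightarrow> ('a \<Rightarrow> 'a) \<Rightarrow> 'a \<Rightarrow> 'a" where
  "rhs A g v = A v + g v"

definition jacobian :: "('a::banach \<Rightarrow> 'a) \<Rightarrow> ('a \<Rightarrow> 'a \<Rightarrow>\<^sub>L 'a) \<Rightarrow> 'a \<Rightarrow> 'a \<Rightarrow> 'a" where
  "jacobian A g1 v x = A x + blinfun_apply (g1 v) x"

definition nonlin_rem :: "('a::banach \<Rightarrow> 'a) \<Rightarrow> ('a \<Rightarrow> 'a \<Rightarrow>\<^sub>L 'a) \<Rightarrow> 'a \<Rightarrow> 'a \<Rightarrow> 'a" where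
  "nonlin_rem g g1 v x = g x - blinfun_apply (g1 v) x"

definition rosenbrock_stage ::
  "real \<Rightarrow> 'a::banach set \<Rightarrow> ('a \<Rightarrow> 'a) \<Rightarrow> ('a \<Rightarrow> 'a) \<Rightarrow> ('a \<Rightarrow> 'a \<Rightarrow>\<^sub>L 'a) \<Rightarrow> real \<Rightarrow> 'a \<Rightarrow> 'a" where
  "rosenbrock_stage c2 D A g g1 h v =
     v + (c2 * h) *\<^sub>R phi_op 1 D (jacobian A g1 v) (c2 * h) (rhs A g v)"

definition rosenbrock_step ::
  "real \<Rightarrow> nat \<Rightarrow> (nat \<Rightarrow> real) \<Rightarrow> 'a::banach set \<Rightarrow> ('a \<Rightarrow> 'a) \<Rightarrow> ('a \<Rightarrow> 'a) \<Rightarrow>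
   ('a \<Rightarrow> 'a \<Rightarrow>\<^sub>L 'a) \<Rightarrow> real \<Rightarrow> 'a \<Rightarrow> 'a" where
  "rosenbrock_step c2 m \<beta> D A g g1 h v =
     v + h *\<^sub>R phi_op 1 D (jacobian A g1 v) h (rhs A g v)
       + h *\<^sub>R phi_comb_op m \<beta> D (jacobian A g1 v) h
           (nonlin_rem g g1 v (rosenbrock_stage c2 D A g g1 h v) - nonlin_rem g g1 v v)"

definition local_error ::
  "real \<Rightarrow> nat \<Rightarrow> (nat \<Rightarrow> real) \<Rightarrow> 'a::banach set \<Rightarrow> ('a \<Rightarrow> 'a) \<Rightarrow> ('a \<Rightarrow> 'a) \<Rightarrow>
   ('a \<Rightarrow> 'a \<Rightarrow>\<^sub>L 'a) \<Rightarrow> (real \<Rightarrow> 'a) \<Rightarrow> real \<Rightarrow> real \<Rightarrow> nat \<Rightarrow> 'a" where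
  "local_error c2 m \<beta> D A g g1 u t0 h n =
     rosenbrock_step c2 m \<beta> D A g g1 h (u (t0 + real n * h)) - u (t0 + real (Suc n) * h)"


section \<open>Assumptions on the initial value problem\<close>

definition classical_solution ::
  "'a::banach set \<Rightarrow> ('a \<Rightarrow> 'a) \<Rightarrow> ('a \<Rightarrow> 'a) \<Rightarrow> real \<Rightarrow> real \<Rightarrow> 'a \<Rightarrow> (real \<Rightarrow> 'a) \<Rightarrow> bool" where
  "classical_solution D A g T t0 u0 u \<longleftrightarrow>
     t0 \<in> {0..T} \<and> u t0 = u0 \<and>
     (\<forall>t\<in>{0..T}. u t \<in> D \<and> (u has_vector_derivative rhs A g (u t)) (at t within {0..T}))"

text \<open>\<open>u1\<close>, \dots, \<open>u4\<close> are the derivatives of \<open>u\<close>, which exist up to order four on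
  \<open>[0,T]\<close> and are bounded by \<open>L\<close>.\<close>

definition smooth_curve ::
  "real \<Rightarrow> real \<Rightarrow> (real \<Rightarrow> 'a::banach) \<Rightarrow> (real \<Rightarrow> 'a) \<Rightarrow> (real \<Rightarrow> 'a) \<Rightarrow> (real \<Rightarrow> 'a) \<Rightarrow> (real \<Rightarrow> 'a) \<Rightarrow> bool"
where
  "smooth_curve T L u u1 u2 u3 u4 \<longleftrightarrow>
     (\<forall>t\<in>{0..T}.
        (u  has_vector_derivative u1 t) (at t within {0..T}) \<and>
        (u1 has_vector_derivative u2 t) (at t within {0..T}) \<and>
        (u2 has_vector_derivative u3 t) (at t within {0..T}) \<and>
        (u3 has_vector_derivative u4 t) (at t within {0..T}) \<and>
        norm (u1 t) \<le> L \<and> norm (u2 t) \<le> L \<and> norm (u3 t) \<le> L \<and> norm (u4 t) \<le> L)"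

definition strip :: "real \<Rightarrow> real \<Rightarrow> (real \<Rightarrow> 'a::banach) \<Rightarrow> 'a set" where
  "strip T R u = (\<Union>t\<in>{0..T}. ball (u t) R)"

text \<open>\<open>g1\<close>, \dots, \<open>g4\<close> are the Frechet derivatives of \<open>g\<close>, which exist up to order four on
  the open set \<open>V\<close> and are bounded by \<open>K\<close>.\<close>

definition smooth_nonlinearity ::
  "'a::banach set \<Rightarrow> real \<Rightarrow> ('a \<Rightarrow> 'a) \<Rightarrow> ('a \<Rightarrow> 'a \<Rightarrow>\<^sub>L 'a) \<Rightarrow> ('a \<Rightarrow> 'a \<Rightarrow>\<^sub>L 'a \<Rightarrow>\<^sub>L 'a) \<Rightarrow>
   ('a \<Rightarrow> 'a \<Rightarrow>\<^sub>L 'a \<Rightarrow>\<^sub>L 'a \<Rightarrow>\<^sub>L 'a) \<Rightarrow> ('a \<Rightarrow> 'a \<Rightarrow>\<^sub>L 'a \<Rightarrow>\<^sub>L 'a \<Rightarrow>\<^sub>L 'a \<Rightarrow>\<^sub>L 'a) \<Rightarrow> bool" where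
  "smooth_nonlinearity V K g g1 g2 g3 g4 \<longleftrightarrow>
     (\<forall>x\<in>V.
        (g  has_derivative blinfun_apply (g1 x)) (at x) \<and>
        (g1 has_derivative blinfun_apply (g2 x)) (at x) \<and>
        (g2 has_derivative blinfun_apply (g3 x)) (at x) \<and>
        (g3 has_derivative blinfun_apply (g4 x)) (at x) \<and>
        norm (g1 x) \<le> K \<and> norm (g2 x) \<le> K \<and> norm (g3 x) \<le> K \<and> norm (g4 x) \<le> K)"

text \<open>As \<open>n\<close> and \<open>h\<close> vary, the grid points \<open>t\<^sub>n = t\<^sub>0 + n h \<le> T\<close> fill the interval
  \<open>[t\<^sub>0,T]\<close>. For \<open>A\<close> to be applicable, the argument has to lie in \<open>D\<close>.\<close>

definition compatibility_bound ::
  "'a::banach set \<Rightarrow> ('a \<Rightarrow> 'a) \<Rightarrow> ('a \<Rightarrow> 'a \<Rightarrow>\<^sub>L 'a \<Rightarrow>\<^sub>L 'a) \<Rightarrow> ('a \<Rightarrow> 'a \<Rightarrow>\<^sub>L 'a \<Rightarrow>\<^sub>L 'a \<Rightarrow>\<^sub>L 'a) \<Rightarrow>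
   real \<Rightarrow> real \<Rightarrow> real \<Rightarrow> (real \<Rightarrow> 'a) \<Rightarrow> (real \<Rightarrow> 'a) \<Rightarrow> (real \<Rightarrow> 'a) \<Rightarrow> bool" where
  "compatibility_bound D A g2 g3 t0 T B u u1 u2 \<longleftrightarrow>
     (\<forall>t\<in>{t0..T}.
        (let w = g3 (u t) (u1 t) (u1 t) (u1 t) + 3 *\<^sub>R g2 (u t) (u1 t) (u2 t)
         in w \<in> D \<and> norm (A w) \<le> B))"

end

theory Submission
  imports Defs
begin

text \<open>
  \<^bold>\<open>The coefficients.\<close> At the origin the order conditions read \<open>b c\<^sub>2\<^sup>2 = 1/3\<close> and \<open>b c\<^sub>2\<^sup>3 = 1/4\<close> with \<open>b = b\<^sub>2(0)\<close>, hence
  \<open>c\<^sub>2 = 3/4\<close>. Matrices of size one turn the first condition into an identity between scalar functions,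
  and since the functions \<open>\<phi>\<^sub>k\<close> are linearly independent it forces \<open>b\<^sub>2 = (32/9)\<phi>\<^sub>3\<close> coefficient by
  coefficient (\<open>order_conditions_coefficient\<close>). In this form it applies to unbounded generators.

  \<^bold>\<open>The error.\<close> Let \<open>v\<close> be the exact value at the beginning of the step, \<open>J = A + g'(v)\<close>, \<open>y(s)\<close> the
  exact solution after time \<open>s\<close>, and \<open>f(s)\<close> the increment of \<open>x \<mapsto> g x - g'(v) x\<close> from \<open>v\<close> to
  \<open>y(s)\<close>. By variation of constants, the exact solution exceeds the exponential Euler step by
  \<open>\<integral>\<^sub>0\<^sup>h e\<^bsup>(h-s)J\<^esup> f(s) ds\<close>. As the derivative of \<open>x \<mapsto> g x - g'(v) x\<close> vanishes at \<open>v\<close>,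
  \<open>f(s) = (s\<^sup>2/2) a + (s\<^sup>3/6) w + O(s\<^sup>4)\<close>, where \<open>w\<close> is the expression of the compatibility condition
  (\<open>incr_taylor\<close>). The integral is therefore \<open>h\<^sup>3 \<phi>\<^sub>3(hJ) a + h\<^sup>4 \<phi>\<^sub>4(hJ) w + O(h\<^sup>5)\<close>. The internal
  stage is an exponential Euler step too, so it misses \<open>y(c\<^sub>2 h)\<close> by \<open>O(h\<^sup>3)\<close> only; the same vanishing
  derivative improves this to \<open>O(h\<^sup>4)\<close> in the nonlinear remainder (\<open>nonlin_rem_lipschitz\<close>), and the
  correction term of the method equals \<open>h b\<^sub>2(hJ) f(c\<^sub>2 h) + O(h\<^sup>5) = h\<^sup>3 \<phi>\<^sub>3(hJ) a + (h\<^sup>4/4) \<phi>\<^sub>3(hJ) w + O(h\<^sup>5)\<close>.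
  What is left is \<open>h\<^sup>4 (\<phi>\<^sub>3(hJ)/4 - \<phi>\<^sub>4(hJ)) w\<close>. The operator in brackets vanishes at \<open>h = 0\<close>, and on
  the domain of \<open>J\<close> it is of first order in \<open>h\<close> (\<open>phi_op_deviation\<close>): this gives the fifth power
  of \<open>h\<close> (\<open>rosenbrock_step_error\<close>).

  \<^bold>\<open>The semigroup of the Jacobian.\<close> That \<open>J\<close> generates a semigroup at all is the bounded perturbation
  theorem. It is proved here by solving the integral equation of the perturbed orbits with Banach's fixed
  point theorem on the whole half-line, after a shift that makes the given semigroup decay
  (\<open>bounded_perturbation\<close>). For constants that are uniform in the problem data one also needs a bound
  on this semigroup in terms of \<open>M\<close> and \<open>K\<close>; on short time intervals variation of constants gives
  \<open>2M\<close> (\<open>perturbed_semigroup_bound\<close>). The principle of uniform boundedness enters because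
  the supremum that \<open>M\<close> bounds is only meaningful if the norms are bounded.
\<close>

section \<open>The order conditions\<close>

lemma has_real_derivative_power_fact:
  "((\<lambda>x::real. x ^ Suc j / fact (Suc j)) has_real_derivative x ^ j / fact j) (at x within S)"
proof -
  have "((\<lambda>x::real. x ^ Suc j / fact (Suc j)) has_real_derivative (real (Suc j) * x ^ j) / fact (Suc j)) (at x within S)"
    using DERIV_cdivide[OF DERIV_pow[of "Suc j" x S], of "fact (Suc j)"] by simp
  also have "(real (Suc j) * x ^ j) / fact (Suc j) = x ^ j / fact j"
    by (simp only: fact_Suc of_nat_mult of_nat_fact) (simp del: of_nat_Suc)
  finally show ?thesis .
qed

lemma phi_real_zero: "phi k (0::real) = 1 / fact k"
proof (cases k)
  case (Suc j)
  have "((\<lambda>\<theta>::real. \<theta> ^ j / fact j) has_integral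
      (1 ^ Suc j / fact (Suc j) - 0 ^ Suc j / fact (Suc j))) {0..1}"
    by (rule fundamental_theorem_of_calculus)
      (use has_real_derivative_power_fact in
        \<open>auto simp only: has_real_derivative_iff_has_vector_derivative[symmetric]\<close>)
  from integral_unique[OF this] show ?thesis using Suc by (simp del: fact_Suc)
qed simp

text \<open>Integration by parts. For \<open>k > 0\<close> the term \<open>\<phi>\<^sub>k(z)\<close> comes from differentiating \<open>\<theta>\<^sup>k / k!\<close>; for
  \<open>k = 0\<close> that derivative vanishes and \<open>\<phi>\<^sub>0(z) = e\<^sup>z\<close> is the boundary term at \<open>\<theta> = 0\<close>.\<close>

lemma phi_real_recurrence:
  fixes z :: real
  shows "z * phi (Suc k) z = phi k z - 1 / fact k"
proof -
  have D: "((\<lambda>\<theta>. - (\<theta> ^ k / fact k * exp ((1 - \<theta>) * z))) has_real_derivative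
      z * (\<theta> ^ k / fact k * exp ((1 - \<theta>) * z))
      - (if k = 0 then 0 else \<theta> ^ (k - 1) / fact (k - 1) * exp ((1 - \<theta>) * z)))
      (at \<theta> within {0..1})" for \<theta>
  proof (cases k)
    case 0
    then show ?thesis by (auto intro!: derivative_eq_intros)
  next
    case (Suc j)
    have E: "((\<lambda>\<theta>. exp ((1 - \<theta>) * z)) has_real_derivative - z * exp ((1 - \<theta>) * z)) (at \<theta> within {0..1})"
      by (auto intro!: derivative_eq_intros)
    show ?thesis
      using DERIV_minus[OF DERIV_mult'[OF has_real_derivative_power_fact[of j] E]] Suc
      by (simp add: algebra_simps)
  qed
  have "((\<lambda>\<theta>. z * (\<theta> ^ k / fact k * exp ((1 - \<theta>) * z))
      - (if k = 0 then 0 else \<theta> ^ (k - 1) / fact (k - 1) * exp ((1 - \<theta>) * z))) has_integral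
      (- (1 ^ k / fact k * exp ((1 - 1) * z)) - (- (0 ^ k / fact k * exp ((1 - 0) * z))))) {0..1}"
    by (rule fundamental_theorem_of_calculus)
      (use D in \<open>auto simp: has_real_derivative_iff_has_vector_derivative\<close>)
  then have I: "integral {0..1} (\<lambda>\<theta>. z * (\<theta> ^ k / fact k * exp ((1 - \<theta>) * z))
      - (if k = 0 then 0 else \<theta> ^ (k - 1) / fact (k - 1) * exp ((1 - \<theta>) * z)))
      = 0 ^ k * exp z / fact k - 1 / fact k"
    by (simp add: integral_unique)
  have "integral {0..1} (\<lambda>\<theta>. z * (\<theta> ^ k / fact k * exp ((1 - \<theta>) * z))
      - (if k = 0 then 0 else \<theta> ^ (k - 1) / fact (k - 1) * exp ((1 - \<theta>) * z)))
      = z * phi (Suc k) z - (if k = 0 then 0 else phi k z)"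
  proof (subst integral_diff)
    show "(\<lambda>\<theta>. if k = 0 then 0 else \<theta> ^ (k - 1) / fact (k - 1) * exp ((1 - \<theta>) * z)) integrable_on {0..1}"
      by (cases k) (auto intro!: integrable_continuous_real continuous_intros)
  qed (cases k; auto intro!: integrable_continuous_real continuous_intros)+
  with I show ?thesis by (cases k) auto
qed

text \<open>By the recurrence, \<open>\<phi>\<^sub>k(z)\<close> behaves like \<open>e\<^sup>z / z\<^sup>k\<close> for \<open>z \<rightarrow> \<infinity>\<close>: each step divides
  by \<open>z\<close> and changes only the polynomial part.\<close>

lemma phi_real_asymptotics:
  "((\<lambda>z::real. z ^ k * exp (- z) * phi k z) \<longlongrightarrow> 1) at_top"
proof (induction k)
  case 0
  then show ?case by (simp add: exp_minus_inverse mult.commute)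
next
  case (Suc k)
  have "((\<lambda>z::real. z ^ k * exp (- z) * phi k z - (z ^ k / exp z) / fact k) \<longlongrightarrow> 1 - 0 / fact k) at_top"
    by (intro tendsto_intros Suc tendsto_power_div_exp_0) auto
  moreover have "z ^ Suc k * exp (- z) * phi (Suc k) z
      = z ^ k * exp (- z) * phi k z - (z ^ k / exp z) / fact k" for z :: real
  proof -
    have "z ^ Suc k * exp (- z) * phi (Suc k) z = z ^ k * exp (- z) * (z * phi (Suc k) z)"
      by (simp only: power_Suc mult_ac)
    also have "\<dots> = z ^ k * exp (- z) * (phi k z - 1 / fact k)"
      by (simp only: phi_real_recurrence)
    also have "\<dots> = z ^ k * exp (- z) * phi k z - (z ^ k / exp z) / fact k"
      by (simp add: exp_minus field_simps)
    finally show ?thesis .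
  qed
  ultimately show ?case by simp
qed

text \<open>The functions grow at different rates \<open>e\<^sup>z / z\<^sup>k\<close>, so the coefficients of a vanishing combination can
  be read off one after the other, the fastest growing first.\<close>

lemma phi_real_independent:
  fixes \<gamma> :: "nat \<Rightarrow> real"
  assumes zero: "\<And>z::real. (\<Sum>k\<le>N. \<gamma> k * phi k z) = 0" and "r \<le> N"
  shows "\<gamma> r = 0"
  using \<open>r \<le> N\<close>
proof (induction r rule: less_induct)
  case (less r)
  \<comment> \<open>Multiplied by \<open>z\<^sup>r e\<^sup>-\<^sup>z\<close>, only the \<open>r\<close>-th function survives in the limit.\<close>
  have lim: "((\<lambda>z. \<gamma> k * (z ^ r * exp (- z) * phi k z)) \<longlongrightarrow> (if k = r then \<gamma> r else 0)) at_top"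
    if "k \<le> N" for k
  proof (cases k r rule: linorder_cases)
    case less
    with less.IH \<open>k \<le> N\<close> show ?thesis by simp
  next
    case equal
    with tendsto_mult[OF tendsto_const phi_real_asymptotics[of r], of "\<gamma> r"] show ?thesis by simp
  next
    case greater
    have "((\<lambda>z::real. \<gamma> k * ((1 / z ^ (k - r)) * (z ^ k * exp (- z) * phi k z))) \<longlongrightarrow> \<gamma> k * (0 * 1)) at_top"
      using greater
      by (intro tendsto_intros phi_real_asymptotics tendsto_divide_0[OF tendsto_const])
        (auto intro!: filterlim_at_top_imp_at_infinity filterlim_pow_at_top filterlim_ident)
    moreover have "\<forall>\<^sub>F z::real in at_top. \<gamma> k * ((1 / z ^ (k - r)) * (z ^ k * exp (- z) * phi k z))
        = \<gamma> k * (z ^ r * exp (- z) * phi k z)"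
      using eventually_gt_at_top[of 0]
    proof eventually_elim
      case (elim z)
      have "z ^ k = z ^ (k - r) * z ^ r" using greater by (simp flip: power_add)
      with elim show ?case by simp
    qed
    ultimately show ?thesis using greater by (simp add: tendsto_cong)
  qed
  have "((\<lambda>z. \<Sum>k\<le>N. \<gamma> k * (z ^ r * exp (- z) * phi k z)) \<longlongrightarrow> (\<Sum>k\<le>N. if k = r then \<gamma> r else 0)) at_top"
    by (intro tendsto_sum lim) simp
  moreover have "(\<Sum>k\<le>N. \<gamma> k * (z ^ r * exp (- z) * phi k z)) = 0" for z
  proof -
    have "(\<Sum>k\<le>N. \<gamma> k * (z ^ r * exp (- z) * phi k z)) = z ^ r * exp (- z) * (\<Sum>k\<le>N. \<gamma> k * phi k z)"
      by (simp add: sum_distrib_left mult_ac)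
    then show ?thesis by (simp add: zero)
  qed
  ultimately have "((\<lambda>z::real. 0) \<longlongrightarrow> \<gamma> r) at_top" using less.prems by simp
  then show ?case by (simp add: tendsto_const_iff)
qed

lemma pow_mat_1x1: "(mat (Suc 0) (Suc 0) (\<lambda>_. z::real) ^\<^sub>m l) = mat (Suc 0) (Suc 0) (\<lambda>_. z ^ l)"
  by (induction l) (auto simp: scalar_prod_def mult.commute)

lemma exp_mat_1x1: "exp_mat (mat (Suc 0) (Suc 0) (\<lambda>_. z)) = mat (Suc 0) (Suc 0) (\<lambda>_. exp z)"
  by (auto simp: exp_mat_def pow_mat_1x1 exp_def divide_inverse_commute)

lemma phi_mat_1x1: "phi_mat k (mat (Suc 0) (Suc 0) (\<lambda>_. z)) $$ (0, 0) = phi k z"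
proof (cases k)
  case (Suc j)
  have "c \<cdot>\<^sub>m mat (Suc 0) (Suc 0) (\<lambda>_. z) = mat (Suc 0) (Suc 0) (\<lambda>_. c * z)" for c :: real by auto
  with Suc show ?thesis by (simp add: exp_mat_1x1)
qed (simp add: exp_mat_1x1)

text \<open>A matrix of size one is a scalar, and on it the entrywise definitions reduce to the scalar functions.\<close>

lemma order_conditions_scalar:
  assumes "\<forall>d. \<forall>Z \<in> carrier_mat d d. c2\<^sup>2 \<cdot>\<^sub>m phi_comb_mat m \<beta> Z = 2 \<cdot>\<^sub>m phi_mat 3 Z"
  shows "c2\<^sup>2 * (\<Sum>k\<le>m. \<beta> k * phi k (z::real)) = 2 * phi 3 z"
proof -
  let ?Z = "mat (Suc 0) (Suc 0) (\<lambda>_. z) :: real mat"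
  have dims: "dim_row (phi_mat 3 ?Z) = Suc 0" "dim_col (phi_mat 3 ?Z) = Suc 0"
    by (simp_all add: numeral_3_eq_3)
  have "(c2\<^sup>2 \<cdot>\<^sub>m phi_comb_mat m \<beta> ?Z) $$ (0, 0) = (2 \<cdot>\<^sub>m phi_mat 3 ?Z) $$ (0, 0)"
    using assms by (metis mat_carrier)
  then show ?thesis by (simp add: phi_comb_mat_def phi_mat_1x1 dims)
qed

text \<open>With \<open>b = b\<^sub>2(0)\<close> and \<open>c = c\<^sub>2\<close>, at the origin the two conditions read \<open>b c\<^sup>2 = 1/3\<close> and \<open>b c\<^sup>3 = 1/4\<close>.\<close>

lemma order_conditions_node:
  assumes "\<forall>d. \<forall>Z \<in> carrier_mat d d. c2\<^sup>2 \<cdot>\<^sub>m phi_comb_mat m \<beta> Z = 2 \<cdot>\<^sub>m phi_mat 3 Z"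
    and "phi_comb m \<beta> (0::real) * c2 ^ 3 = 6 * phi 4 (0::real)"
  shows "c2 = 3 / 4"
proof -
  have "c2\<^sup>2 * phi_comb m \<beta> (0::real) = 1 / 3"
    using order_conditions_scalar[OF assms(1), of 0]
    by (simp only: phi_comb_def real_scaleR_def phi_real_zero) (simp add: fact_numeral)
  moreover have "c2\<^sup>2 * phi_comb m \<beta> (0::real) * c2 = 1 / 4"
    using assms(2) by (simp only: phi_real_zero) (simp add: fact_numeral power3_eq_cube power2_eq_square mult_ac)
  ultimately have "1 / 3 * c2 = 1 / 4" by metis
  then show ?thesis by simp
qed

text \<open>An identity between functions of matrices says nothing by itself about an unbounded operator. By
  linear independence it fixes the coefficients of the linear combination, however, and these define
  the operator.\<close>

lemma order_conditions_coefficient: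
  assumes "\<forall>d. \<forall>Z \<in> carrier_mat d d. c2\<^sup>2 \<cdot>\<^sub>m phi_comb_mat m \<beta> Z = 2 \<cdot>\<^sub>m phi_mat 3 Z"
    and "phi_comb m \<beta> (0::real) * c2 ^ 3 = 6 * phi 4 (0::real)"
  shows "phi_comb_op m \<beta> D J h x = (32 / 9) *\<^sub>R phi_op 3 D J h x"
proof -
  define N where "N = max m 3"
  define \<gamma> where "\<gamma> k = (9 / 16) * (if k \<le> m then \<beta> k else 0) - (if k = 3 then 2 else 0)" for k
  have sum_m: "(\<Sum>k\<le>N. (if k \<le> m then f k else 0)) = (\<Sum>k\<le>m. f k)" for f :: "nat \<Rightarrow> real"
    by (rule sum.mono_neutral_cong_right) (auto simp: N_def)
  have "(\<Sum>k\<le>N. \<gamma> k * phi k z) = 0" for z :: real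
  proof -
    have "(\<Sum>k\<le>N. \<gamma> k * phi k z)
        = (9 / 16) * (\<Sum>k\<le>N. (if k \<le> m then \<beta> k * phi k z else 0)) - (\<Sum>k\<le>N. if k = 3 then 2 * phi k z else 0)"
      unfolding sum_distrib_left sum_subtractf[symmetric]
      by (rule sum.cong) (auto simp: \<gamma>_def algebra_simps)
    also have "\<dots> = (9 / 16) * (\<Sum>k\<le>m. \<beta> k * phi k z) - 2 * phi 3 z"
      unfolding sum_m by (simp add: N_def)
    finally show ?thesis
      using order_conditions_scalar[OF assms(1), of z] order_conditions_node[OF assms]
      by (simp add: power2_eq_square)
  qed
  then have \<gamma>0: "\<gamma> k = 0" if "k \<le> N" for k using phi_real_independent that by blast
  have "3 \<le> m" using \<gamma>0[of 3] by (auto simp: \<gamma>_def N_def split: if_splits)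
  have "\<beta> k = (if k = 3 then 32 / 9 else 0)" if "k \<le> m" for k
    using \<gamma>0[of k] that by (auto simp: \<gamma>_def N_def split: if_splits)
  then have "phi_comb_op m \<beta> D J h x = (\<Sum>k\<le>m. if k = 3 then (32 / 9) *\<^sub>R phi_op k D J h x else 0)"
    unfolding phi_comb_op_def by (intro sum.cong) auto
  with \<open>3 \<le> m\<close> show ?thesis by simp
qed

section \<open>Strongly continuous semigroups and convolutions\<close>

text \<open>The principle of uniform boundedness, from Baire's theorem: one of the closed sets on which all
  \<open>f n\<close> are bounded by \<open>k\<close> contains a ball.\<close>

lemma uniform_boundedness:
  fixes f :: "nat \<Rightarrow> 'a::banach \<Rightarrow>\<^sub>L 'b::real_normed_vector"
  assumes pw: "\<And>x. bounded (range (\<lambda>n. blinfun_apply (f n) x))"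
  shows "bounded (range f)"
proof -
  define F where "F k = {x. \<forall>n. norm (blinfun_apply (f n) x) \<le> real k}" for k
  have closed: "closed (F k)" for k
    unfolding F_def by (intro closed_Collect_all closed_Collect_le continuous_intros)
  have cover: "(\<Union>k. F k) = UNIV"
  proof safe
    fix x
    obtain c where "\<And>n. norm (blinfun_apply (f n) x) \<le> c"
      using pw[of x] by (auto simp: bounded_iff)
    moreover obtain k :: nat where "c \<le> real k" using real_arch_simple by blast
    ultimately have "x \<in> F k" by (auto simp: F_def intro: order_trans)
    then show "x \<in> (\<Union>k. F k)" by blast
  qed auto
  have "\<exists>k. interior (F k) \<noteq> {}"
  proof (rule ccontr)
    assume "\<not> ?thesis"
    then have "euclidean interior_of \<Union>(range F) = {}"
      using closed
      by (intro Met_TC.metric_Baire_category_alt[unfolded mtopology_is_euclidean])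
        (auto simp: complete_UNIV_cuspace)
    then show False by (simp add: cover)
  qed
  then obtain k a where "a \<in> interior (F k)" by blast
  then obtain r where r: "0 < r" "cball a r \<subseteq> F k"
    by (meson mem_interior_cball)
  have "norm (f n) \<le> 2 * real k / r" for n
  proof (rule norm_blinfun_bound)
    fix x
    show "norm (blinfun_apply (f n) x) \<le> 2 * real k / r * norm x"
    proof (cases "x = 0")
      case False
      define y where "y = (r / norm x) *\<^sub>R x"
      have "norm y = r" using False r by (simp add: y_def)
      then have "a + y \<in> F k" "a \<in> F k" using r by (auto simp: dist_norm)
      then have "norm (blinfun_apply (f n) (a + y)) \<le> k" "norm (blinfun_apply (f n) a) \<le> k"
        by (auto simp: F_def)
      then have "norm (blinfun_apply (f n) (a + y) - blinfun_apply (f n) a) \<le> 2 * real k"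
        using norm_triangle_ineq4[of "blinfun_apply (f n) (a + y)" "blinfun_apply (f n) a"] by linarith
      then have "norm (blinfun_apply (f n) y) \<le> 2 * real k" by (simp add: blinfun.add_right)
      then have "(r / norm x) * norm (blinfun_apply (f n) x) \<le> 2 * real k"
        using r by (simp add: y_def blinfun.scaleR_right)
      then show ?thesis using False r by (simp add: field_simps)
    qed simp
  qed (use r in simp)
  then show ?thesis by (auto simp: bounded_iff)
qed

lemma
  assumes "c0_semigroup S"
  shows c0_semigroup_zero: "S 0 = id_blinfun"
    and c0_semigroup_add: "\<And>s t. 0 \<le> s \<Longrightarrow> 0 \<le> t \<Longrightarrow> S (s + t) = S s o\<^sub>L S t"
    and c0_semigroup_at_zero: "\<And>x. ((\<lambda>t. blinfun_apply (S t) x) \<longlongrightarrow> x) (at_right 0)"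
  using assms by (auto simp: c0_semigroup_def)

lemma c0_semigroup_add_apply:
  assumes "c0_semigroup S" "0 \<le> s" "0 \<le> t"
  shows "blinfun_apply (S (s + t)) x = S s (blinfun_apply (S t) x)"
  using assms by (simp add: c0_semigroup_add)

text \<open>Otherwise there are times tending to \<open>0\<close> along which the norms blow up, although every orbit
  converges; this contradicts uniform boundedness.\<close>

lemma c0_semigroup_bounded_near_zero:
  assumes S: "c0_semigroup (S :: real \<Rightarrow> 'a::banach \<Rightarrow>\<^sub>L 'a)"
  shows "\<exists>\<delta>>0. \<exists>N. \<forall>t\<in>{0..\<delta>}. norm (S t) \<le> N"
proof (rule ccontr)
  assume *: "\<not> ?thesis"
  have "\<exists>t\<in>{0..1 / real (Suc n)}. real n < norm (S t)" for n
    using *[simplified] by (metis not_le of_nat_0_less_iff zero_less_Suc zero_less_divide_1_iff)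
  then obtain \<tau> where \<tau>: "\<And>n. \<tau> n \<in> {0..1 / real (Suc n)}" "\<And>n. real n < norm (S (\<tau> n))"
    by metis
  have lim0: "\<tau> \<longlonglongrightarrow> 0"
    by (rule tendsto_sandwich[OF _ _ tendsto_const LIMSEQ_Suc[OF lim_1_over_n]])
      (use \<tau>(1) in auto)
  have "bounded (range (\<lambda>n. blinfun_apply (S (\<tau> n)) x))" for x
  proof -
    have "continuous (at 0 within {0..}) (\<lambda>t. blinfun_apply (S t) x)"
      using c0_semigroup_at_zero[OF S, of x] c0_semigroup_zero[OF S]
      by (simp add: continuous_within at_within_Ici_at_right)
    with lim0 \<tau>(1) have "((\<lambda>t. blinfun_apply (S t) x) \<circ> \<tau>) \<longlonglongrightarrow> S 0 x"
      unfolding continuous_within_sequentially by auto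
    then show ?thesis unfolding o_def by (rule convergent_imp_bounded)
  qed
  then have "bounded (range (\<lambda>n. S (\<tau> n)))" by (rule uniform_boundedness)
  then obtain c where c: "\<And>n. norm (S (\<tau> n)) \<le> c" by (auto simp: bounded_iff)
  obtain n where "c < real n" using reals_Archimedean2 by blast
  with c[of n] \<tau>(2)[of n] show False by linarith
qed

lemma c0_semigroup_growth:
  assumes S: "c0_semigroup (S :: real \<Rightarrow> 'a::banach \<Rightarrow>\<^sub>L 'a)"
  obtains M \<omega> where "1 \<le> M" "0 \<le> \<omega>" "\<And>t. 0 \<le> t \<Longrightarrow> norm (S t) \<le> M * exp (\<omega> * t)"
proof -
  obtain \<delta> N0 where \<delta>: "0 < \<delta>" "\<And>t. t \<in> {0..\<delta>} \<Longrightarrow> norm (S t) \<le> N0"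
    using c0_semigroup_bounded_near_zero[OF S] by blast
  define N where "N = max 1 N0"
  define \<omega> where "\<omega> = ln N / \<delta>"
  have N: "1 \<le> N" "\<And>t. t \<in> {0..\<delta>} \<Longrightarrow> norm (S t) \<le> N" using \<delta> by (auto simp: N_def le_max_iff_disj)
  have \<omega>: "0 \<le> \<omega>" "exp (\<omega> * \<delta>) = N" using N \<delta> by (auto simp: \<omega>_def)
  \<comment> \<open>The rate is chosen such that \<open>e\<^sup>\<omega>\<^sup>\<delta> = N\<close>: each further step of length \<open>\<delta>\<close> costs exactly one factor \<open>N\<close>.\<close>
  have step: "norm (S t) \<le> N * exp (\<omega> * t)" if "0 \<le> t" "t \<le> real n * \<delta>" for t n
    using that
  proof (induction n arbitrary: t)
    case 0
    then have "t = 0" by simp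
    then show ?case using N(2)[of 0] \<delta> by simp
  next
    case (Suc n)
    show ?case
    proof (cases "t \<le> \<delta>")
      case True
      then have "norm (S t) \<le> N * 1" using N(2)[of t] Suc.prems by simp
      also have "\<dots> \<le> N * exp (\<omega> * t)" using N \<omega> Suc.prems by (intro mult_left_mono) auto
      finally show ?thesis .
    next
      case False
      have "norm (S (t - \<delta>)) \<le> N * exp (\<omega> * (t - \<delta>))"
        using False Suc.prems by (intro Suc.IH) (auto simp: algebra_simps)
      moreover have "S t = S \<delta> o\<^sub>L S (t - \<delta>)"
        using c0_semigroup_add[OF S, of \<delta> "t - \<delta>"] \<delta> False by simp
      moreover have "norm (S \<delta>) \<le> N" using N(2)[of \<delta>] \<delta> by simp
      ultimately have "norm (S t) \<le> N * (N * exp (\<omega> * (t - \<delta>)))"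
        using N(1) by (auto intro!: order_trans[OF norm_blinfun_compose] mult_mono)
      also have "\<dots> = N * exp (\<omega> * t)"
        by (simp add: right_diff_distrib exp_diff \<omega>)
      finally show ?thesis .
    qed
  qed
  have "norm (S t) \<le> N * exp (\<omega> * t)" if "0 \<le> t" for t
  proof -
    obtain n where "t / \<delta> < real n" using reals_Archimedean2 by blast
    then show ?thesis using step[OF that, of n] \<delta> by (simp add: field_simps)
  qed
  with that N(1) \<omega>(1) show thesis by blast
qed

text \<open>A supremum of norms over a compact time interval is therefore a genuine upper bound.\<close>

lemma c0_semigroup_bdd_above:
  assumes "c0_semigroup (S :: real \<Rightarrow> 'a::banach \<Rightarrow>\<^sub>L 'a)"
  shows "bdd_above ((\<lambda>t. norm (S t)) ` {0..\<tau>})"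
proof -
  obtain M \<omega> where *: "1 \<le> M" "0 \<le> \<omega>" "\<And>t. 0 \<le> t \<Longrightarrow> norm (S t) \<le> M * exp (\<omega> * t)"
    using c0_semigroup_growth[OF assms] by blast
  have "norm (S t) \<le> M * exp (\<omega> * \<tau>)" if "t \<in> {0..\<tau>}" for t
  proof -
    have "M * exp (\<omega> * t) \<le> M * exp (\<omega> * \<tau>)" using * that by (auto intro!: mult_left_mono)
    with *(3)[of t] that show ?thesis by auto
  qed
  then show ?thesis by (rule bdd_aboveI2)
qed

lemma c0_semigroup_continuous_orbit:
  assumes S: "c0_semigroup (S :: real \<Rightarrow> 'a::banach \<Rightarrow>\<^sub>L 'a)"
  shows "continuous_on {0..} (\<lambda>t. blinfun_apply (S t) x)"
proof -
  obtain M \<omega> where growth: "1 \<le> M" "0 \<le> \<omega>" "\<And>t. 0 \<le> t \<Longrightarrow> norm (S t) \<le> M * exp (\<omega> * t)"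
    using c0_semigroup_growth[OF S] by blast
  show ?thesis
    unfolding continuous_on_def
  proof (intro ballI)
    fix t :: real assume t: "t \<in> {0..}"
    \<comment> \<open>Both one-sided limits at once: \<open>S(s)x\<close> and \<open>S(t)x\<close> differ by \<open>S(min s t)\<close> applied to \<open>S(\<bar>s-t\<bar>)x - x\<close>.\<close>
    have le: "norm (S s x - S t x) \<le> M * exp (\<omega> * min s t) * norm (S \<bar>s - t\<bar> x - x)"
      if "0 \<le> s" for s
    proof -
      have "norm (S s x - S t x) = norm (S (min s t) (S \<bar>s - t\<bar> x - x))"
      proof (cases "s \<le> t")
        case True
        have "S t x = S s (S (t - s) x)" using c0_semigroup_add_apply[OF S, of s "t - s" x] that True by simp
        with True show ?thesis by (simp add: blinfun.diff_right norm_minus_commute)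
      next
        case False
        have "S s x = S t (S (s - t) x)" using c0_semigroup_add_apply[OF S, of t "s - t" x] t False by simp
        with False show ?thesis by (simp add: blinfun.diff_right)
      qed
      also have "\<dots> \<le> norm (S (min s t)) * norm (S \<bar>s - t\<bar> x - x)" by (rule norm_blinfun)
      also have "\<dots> \<le> M * exp (\<omega> * min s t) * norm (S \<bar>s - t\<bar> x - x)"
        using growth(3)[of "min s t"] that t by (intro mult_right_mono) auto
      finally show ?thesis .
    qed
    have cont0: "continuous (at 0 within {0..}) (\<lambda>t. blinfun_apply (S t) x)"
      using c0_semigroup_at_zero[OF S, of x] c0_semigroup_zero[OF S]
      by (simp add: continuous_within at_within_Ici_at_right)
    have "((\<lambda>s. \<bar>s - t\<bar>) \<longlongrightarrow> 0) (at t within {0..})"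
      by (rule tendsto_eq_intros refl | simp)+
    then have "((\<lambda>s. S \<bar>s - t\<bar> x) \<longlongrightarrow> S 0 x) (at t within {0..})"
      by (intro continuous_within_tendsto_compose'[OF cont0]) auto
    then have "((\<lambda>s. M * exp (\<omega> * min s t) * norm (S \<bar>s - t\<bar> x - x)) \<longlongrightarrow>
        M * exp (\<omega> * min t t) * norm (S 0 x - x)) (at t within {0..})"
      by (intro tendsto_mult tendsto_exp tendsto_min tendsto_norm tendsto_diff tendsto_const tendsto_ident_at)
    then have "((\<lambda>s. M * exp (\<omega> * min s t) * norm (S \<bar>s - t\<bar> x - x)) \<longlongrightarrow> 0) (at t within {0..})"
      by (simp add: c0_semigroup_zero[OF S])
    moreover have "\<forall>\<^sub>F s in at t within {0..}.
        norm (S s x - S t x) \<le> M * exp (\<omega> * min s t) * norm (S \<bar>s - t\<bar> x - x)"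
      unfolding eventually_at_filter by (rule always_eventually) (use le in auto)
    ultimately have "((\<lambda>s. S s x - S t x) \<longlongrightarrow> 0) (at t within {0..})"
      by (rule Lim_null_comparison[rotated])
    then show "((\<lambda>t. blinfun_apply (S t) x) \<longlongrightarrow> S t x) (at t within {0..})"
      by (rule Lim_null[THEN iffD2])
  qed
qed

text \<open>Joint continuity in time and argument: by the growth bound, a small change of the argument has a small
  effect, uniformly in time.\<close>

lemma c0_semigroup_tendsto:
  assumes S: "c0_semigroup (S :: real \<Rightarrow> 'a::banach \<Rightarrow>\<^sub>L 'a)"
    and \<tau>: "(\<tau> \<longlongrightarrow> t) F" "\<forall>\<^sub>F u in F. 0 \<le> \<tau> u" "0 \<le> t" and f: "(f \<longlongrightarrow> x) F"
  shows "((\<lambda>u. blinfun_apply (S (\<tau> u)) (f u)) \<longlongrightarrow> S t x) F"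
proof -
  obtain M \<omega> where growth: "1 \<le> M" "0 \<le> \<omega>" "\<And>t. 0 \<le> t \<Longrightarrow> norm (S t) \<le> M * exp (\<omega> * t)"
    using c0_semigroup_growth[OF S] by blast
  have "((\<lambda>u. M * exp (\<omega> * \<tau> u) * norm (f u - x)) \<longlongrightarrow> M * exp (\<omega> * t) * norm (x - x)) F"
    by (intro tendsto_intros \<tau> f)
  then have "((\<lambda>u. M * exp (\<omega> * \<tau> u) * norm (f u - x)) \<longlongrightarrow> 0) F" by simp
  moreover have "\<forall>\<^sub>F u in F. norm (S (\<tau> u) (f u - x)) \<le> M * exp (\<omega> * \<tau> u) * norm (f u - x)"
    using \<tau>(2)
  proof eventually_elim
    case (elim u)
    have "norm (S (\<tau> u) (f u - x)) \<le> norm (S (\<tau> u)) * norm (f u - x)" by (rule norm_blinfun)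
    also have "\<dots> \<le> M * exp (\<omega> * \<tau> u) * norm (f u - x)"
      using growth(3)[OF elim] by (intro mult_right_mono) auto
    finally show ?case .
  qed
  ultimately have "((\<lambda>u. S (\<tau> u) (f u - x)) \<longlongrightarrow> 0) F" by (rule Lim_null_comparison[rotated])
  moreover have "((\<lambda>u. S (\<tau> u) x) \<longlongrightarrow> S t x) F"
    by (rule continuous_on_tendsto_compose[OF c0_semigroup_continuous_orbit[OF S] \<tau>(1)]) (use \<tau> in auto)
  ultimately have "((\<lambda>u. S (\<tau> u) (f u - x) + S (\<tau> u) x) \<longlongrightarrow> 0 + S t x) F"
    by (rule tendsto_add)
  then show ?thesis by (simp add: blinfun.diff_right)
qed

lemma c0_semigroup_continuous_on:
  assumes "c0_semigroup (S :: real \<Rightarrow> 'a::banach \<Rightarrow>\<^sub>L 'a)"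
    and "continuous_on U \<tau>" "continuous_on U f" "\<And>u. u \<in> U \<Longrightarrow> 0 \<le> \<tau> u"
  shows "continuous_on U (\<lambda>u. blinfun_apply (S (\<tau> u)) (f u))"
  unfolding continuous_on_def
  by (intro ballI c0_semigroup_tendsto[OF assms(1)])
    (use assms in \<open>auto simp: continuous_on_def eventually_at_topological\<close>)

lemma has_integral_norm_bound:
  fixes f :: "real \<Rightarrow> 'a::real_normed_vector"
  assumes "0 \<le> h" "(f has_integral i) {0..h}" "\<And>s. s \<in> {0..h} \<Longrightarrow> norm (f s) \<le> c"
  shows "norm i \<le> c * h"
proof -
  have "0 \<le> c" using assms(1) order_trans[OF norm_ge_zero assms(3)[of 0]] by auto
  then show ?thesis using has_integral_bound[of c f i 0 h] assms by auto
qed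

text \<open>Scaling the interval of integration to \<open>[0,1]\<close> turns an integral with variable upper limit
  into one with a parameter only; \<open>\<phi>\<^sub>k(hJ)\<close> is defined in the scaled form.\<close>

lemma integral_scale_unit:
  fixes f :: "real \<Rightarrow> 'a::real_normed_vector"
  assumes "0 < t"
  shows "t *\<^sub>R integral {0..1} (\<lambda>\<theta>. f (t * \<theta>)) = integral {0..t} f"
proof -
  have "(\<lambda>x. x / t) ` {0..t} = {0..1}"
    using assms by (simp add: image_divide_atLeastAtMost)
  then show ?thesis using integral_stretch_real[of t 0 t f] assms by simp
qed

lemma convolution_scaled:
  assumes "0 \<le> t"
  shows "integral {0..t} (\<lambda>r. blinfun_apply (S (t - r)) (f r))
    = t *\<^sub>R integral {0..1} (\<lambda>\<theta>. blinfun_apply (S (t * (1 - \<theta>))) (f (t * \<theta>)))"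
proof (cases "t = 0")
  case False
  with assms integral_scale_unit[of t "\<lambda>r. blinfun_apply (S (t - r)) (f r)"]
  show ?thesis by (simp add: right_diff_distrib)
qed simp

context
  fixes S :: "real \<Rightarrow> 'a::banach \<Rightarrow>\<^sub>L 'a"
  assumes S: "c0_semigroup S"
begin

lemma convolution_integrable:
  assumes "continuous_on {0..t} f"
  shows "(\<lambda>r. blinfun_apply (S (t - r)) (f r)) integrable_on {0..t}"
  using assms by (intro integrable_continuous_real c0_semigroup_continuous_on[OF S] continuous_intros) auto

lemma convolution_kernel_continuous:
  assumes "continuous_on {0..} f"
  shows "continuous_on {0..} (\<lambda>t. integral {0..1} (\<lambda>\<theta>. blinfun_apply (S (t * (1 - \<theta>))) (f (t * \<theta>))))"
proof -
  have "continuous_on ({0..} \<times> cbox 0 1) (\<lambda>(t, \<theta>). blinfun_apply (S (t * (1 - \<theta>))) (f (t * \<theta>)))"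
    unfolding split_beta
    by (intro c0_semigroup_continuous_on[OF S] continuous_intros continuous_on_compose2[OF assms]) auto
  from integral_continuous_on_param[OF this] show ?thesis by simp
qed

lemma convolution_continuous:
  assumes "continuous_on {0..} f"
  shows "continuous_on {0..} (\<lambda>t. integral {0..t} (\<lambda>r. blinfun_apply (S (t - r)) (f r)))"
  by (rule continuous_on_eq[where f = "\<lambda>t. t *\<^sub>R integral {0..1} (\<lambda>\<theta>. S (t * (1 - \<theta>)) (f (t * \<theta>)))"])
    (auto simp: convolution_scaled intro!: continuous_intros convolution_kernel_continuous assms)

lemma convolution_quotient:
  assumes "continuous_on {0..} f"
  shows "((\<lambda>t. (1 / t) *\<^sub>R integral {0..t} (\<lambda>r. blinfun_apply (S (t - r)) (f r))) \<longlongrightarrow> f 0) (at_right 0)"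
proof -
  have "((\<lambda>t. integral {0..1} (\<lambda>\<theta>. S (t * (1 - \<theta>)) (f (t * \<theta>)))) \<longlongrightarrow>
      integral {0..1} (\<lambda>\<theta>. S (0 * (1 - \<theta>)) (f (0 * \<theta>)))) (at 0 within {0..})"
    using convolution_kernel_continuous[OF assms] unfolding continuous_on_def by (rule bspec) simp
  then have "((\<lambda>t. integral {0..1} (\<lambda>\<theta>. S (t * (1 - \<theta>)) (f (t * \<theta>)))) \<longlongrightarrow> f 0) (at_right 0)"
    by (simp add: c0_semigroup_zero[OF S] at_within_Ici_at_right)
  moreover have "\<forall>\<^sub>F t in at_right 0. integral {0..1} (\<lambda>\<theta>. S (t * (1 - \<theta>)) (f (t * \<theta>)))
      = (1 / t) *\<^sub>R integral {0..t} (\<lambda>r. blinfun_apply (S (t - r)) (f r))"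
    by (rule eventually_at_rightI[of 0 1]) (auto simp: convolution_scaled)
  ultimately show ?thesis by (rule Lim_transform_eventually)
qed

text \<open>For \<open>r \<le> s\<close> the factor \<open>S(t)\<close> can be split off from \<open>S(s + t - r)\<close>; the rest of the integral is shifted.\<close>

lemma convolution_split:
  assumes f: "continuous_on {0..} f" and st: "0 \<le> s" "0 \<le> t"
  shows "integral {0..s + t} (\<lambda>r. blinfun_apply (S (s + t - r)) (f r))
    = S t (integral {0..s} (\<lambda>r. S (s - r) (f r))) + integral {0..t} (\<lambda>r. S (t - r) (f (s + r)))"
proof -
  have cont: "continuous_on {0..b} f" for b using f by (rule continuous_on_subset) auto
  have "integral {0..s + t} (\<lambda>r. S (s + t - r) (f r))
      = integral {0..s} (\<lambda>r. S (s + t - r) (f r)) + integral {s..s + t} (\<lambda>r. S (s + t - r) (f r))"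
    using st convolution_integrable[OF cont] by (intro Henstock_Kurzweil_Integration.integral_combine[symmetric]) auto
  also have "integral {0..s} (\<lambda>r. S (s + t - r) (f r)) = integral {0..s} (\<lambda>r. S t (S (s - r) (f r)))"
  proof (rule integral_cong)
    fix r assume "r \<in> {0..s}"
    then show "S (s + t - r) (f r) = S t (S (s - r) (f r))"
      using c0_semigroup_add_apply[OF S, of t "s - r" "f r"] st by (simp add: algebra_simps)
  qed
  also have "\<dots> = S t (integral {0..s} (\<lambda>r. S (s - r) (f r)))"
    using integral_linear[OF convolution_integrable[OF cont] blinfun.bounded_linear_right, of s "S t"]
    by (simp add: o_def)
  also have "integral {s..s + t} (\<lambda>r. S (s + t - r) (f r)) = integral {0..t} (\<lambda>r. S (t - r) (f (s + r)))"
    using integral_shift_real_ivl[of s s "s + t" "\<lambda>r. S (s + t - r) (f r)"] by (simp add: add.commute)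
  finally show ?thesis .
qed

end

section \<open>Generators and variation of constants\<close>

lemma generates_c0: "generates D A S \<Longrightarrow> c0_semigroup S"
  by (simp add: generates_def)

lemma generates_iff:
  "generates D A S \<Longrightarrow> x \<in> D \<and> A x = y \<longleftrightarrow>
    ((\<lambda>h. (1 / h) *\<^sub>R (blinfun_apply (S h) x - x)) \<longlongrightarrow> y) (at_right 0)"
  by (simp add: generates_def)

lemma generates_tendsto:
  "generates D A S \<Longrightarrow> x \<in> D \<Longrightarrow>
    ((\<lambda>h. (1 / h) *\<^sub>R (blinfun_apply (S h) x - x)) \<longlongrightarrow> A x) (at_right 0)"
  using generates_iff by blast

lemma generator_add:
  assumes "generates D A S" "x \<in> D" "y \<in> D"
  shows "x + y \<in> D \<and> A (x + y) = A x + A y"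
proof -
  have "((\<lambda>h. (1 / h) *\<^sub>R (S h x - x) + (1 / h) *\<^sub>R (S h y - y)) \<longlongrightarrow> A x + A y) (at_right 0)"
    by (intro tendsto_add generates_tendsto[OF assms(1)] assms)
  then show ?thesis
    by (simp add: generates_iff[OF assms(1)] blinfun.add_right algebra_simps)
qed

lemma generator_scaleR:
  assumes "generates D A S" "x \<in> D"
  shows "c *\<^sub>R x \<in> D \<and> A (c *\<^sub>R x) = c *\<^sub>R A x"
proof -
  have "((\<lambda>h. c *\<^sub>R ((1 / h) *\<^sub>R (S h x - x))) \<longlongrightarrow> c *\<^sub>R A x) (at_right 0)"
    by (intro tendsto_intros generates_tendsto[OF assms(1)] assms)
  then show ?thesis
    by (simp add: generates_iff[OF assms(1)] blinfun.scaleR_right scaleR_diff_right mult.commute)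
qed

lemma generator_diff:
  assumes "generates D A S" "x \<in> D" "y \<in> D"
  shows "x - y \<in> D \<and> A (x - y) = A x - A y"
  using generator_add[OF assms(1,2), of "- 1 *\<^sub>R y"] generator_scaleR[OF assms(1,3), of "- 1"] by simp

lemma semigroup_generator_commute:
  assumes gen: "generates D A S" and x: "x \<in> D" and t: "0 \<le> t"
  shows "blinfun_apply (S t) x \<in> D \<and> A (S t x) = S t (A x)"
proof -
  note S = generates_c0[OF gen]
  have "((\<lambda>h. S t ((1 / h) *\<^sub>R (S h x - x))) \<longlongrightarrow> S t (A x)) (at_right 0)"
    by (intro tendsto_intros generates_tendsto[OF gen x])
  moreover have "\<forall>\<^sub>F h in at_right 0. S t ((1 / h) *\<^sub>R (S h x - x)) = (1 / h) *\<^sub>R (S h (S t x) - S t x)"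
  proof (rule eventually_at_rightI[of 0 1])
    fix h :: real assume "h \<in> {0<..<1}"
    then have "S h (S t x) = S t (S h x)"
      using c0_semigroup_add_apply[OF S, of h t x] c0_semigroup_add_apply[OF S, of t h x] t
      by (simp add: add.commute)
    then show "S t ((1 / h) *\<^sub>R (S h x - x)) = (1 / h) *\<^sub>R (S h (S t x) - S t x)"
      by (simp add: blinfun.scaleR_right blinfun.diff_right)
  qed simp
  ultimately have "((\<lambda>h. (1 / h) *\<^sub>R (S h (S t x) - S t x)) \<longlongrightarrow> S t (A x)) (at_right 0)"
    by (rule Lim_transform_eventually)
  then show ?thesis using generates_iff[OF gen] by blast
qed

lemma has_vector_derivative_quotient:
  "(f has_vector_derivative f') (at x within X) \<longleftrightarrow>
    ((\<lambda>y. (1 / (y - x)) *\<^sub>R (f y - f x)) \<longlongrightarrow> f') (at x within X)"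
proof -
  have "norm ((1 / norm (y - x)) *\<^sub>R (f y - (f x + (y - x) *\<^sub>R f'))) =
      norm ((1 / (y - x)) *\<^sub>R (f y - f x) - f')" if "y \<noteq> x" for y
  proof -
    have "(1 / (y - x)) *\<^sub>R (f y - f x) - f' = (1 / (y - x)) *\<^sub>R (f y - (f x + (y - x) *\<^sub>R f'))"
      using that by (simp add: scaleR_diff_right scaleR_add_right)
    then show ?thesis by simp
  qed
  then have eq: "\<forall>\<^sub>F y in at x within X. norm ((1 / norm (y - x)) *\<^sub>R (f y - (f x + (y - x) *\<^sub>R f'))) =
      norm ((1 / (y - x)) *\<^sub>R (f y - f x) - f')"
    by (auto simp: eventually_at_filter)
  have "(f has_vector_derivative f') (at x within X) \<longleftrightarrow>
      ((\<lambda>y. norm ((1 / norm (y - x)) *\<^sub>R (f y - (f x + (y - x) *\<^sub>R f')))) \<longlongrightarrow> 0) (at x within X)"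
    unfolding tendsto_norm_zero_iff
    by (simp add: has_vector_derivative_def has_derivative_within bounded_linear_scaleR_left)
  also have "\<dots> \<longleftrightarrow> ((\<lambda>y. norm ((1 / (y - x)) *\<^sub>R (f y - f x) - f')) \<longlongrightarrow> 0) (at x within X)"
    by (rule tendsto_cong[OF eq])
  also have "\<dots> \<longleftrightarrow> ((\<lambda>y. (1 / (y - x)) *\<^sub>R (f y - f x)) \<longlongrightarrow> f') (at x within X)"
    by (simp add: tendsto_norm_zero_iff Lim_null[of _ f'])
  finally show ?thesis .
qed

text \<open>The generator only gives the right derivative at \<open>0\<close>. For \<open>s \<noteq> t\<close> the difference quotient
  at \<open>t\<close> is \<open>S(min s t)\<close> applied to the one at \<open>0\<close> with step \<open>\<bar>s - t\<bar>\<close>, and joint continuity of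
  \<open>(t,x) \<mapsto> S(t)x\<close> gives the two-sided limit.\<close>

lemma semigroup_orbit_derivative:
  assumes gen: "generates D A S" and x: "x \<in> D" and t: "0 \<le> t"
  shows "((\<lambda>s. blinfun_apply (S s) x) has_vector_derivative S t (A x)) (at t within {0..})"
proof -
  note S = generates_c0[OF gen]
  define q where "q h = (1 / h) *\<^sub>R (blinfun_apply (S h) x - x)" for h
  have "(q \<longlongrightarrow> A x) (at_right 0)" unfolding q_def by (rule generates_tendsto[OF gen x])
  moreover have "filterlim (\<lambda>s. \<bar>s - t\<bar>) (at_right 0) (at t within {0..})"
  proof (rule tendsto_imp_filterlim_at_right)
    show "((\<lambda>s. \<bar>s - t\<bar>) \<longlongrightarrow> 0) (at t within {0..})"
      by (rule tendsto_eq_intros refl | simp)+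
  qed (simp add: eventually_at_filter)
  ultimately have "((\<lambda>s. q \<bar>s - t\<bar>) \<longlongrightarrow> A x) (at t within {0..})"
    by (rule filterlim_compose)
  moreover have "((\<lambda>s. min s t) \<longlongrightarrow> t) (at t within {0..})"
    by (rule tendsto_eq_intros refl | simp)+
  ultimately have "((\<lambda>s. S (min s t) (q \<bar>s - t\<bar>)) \<longlongrightarrow> S t (A x)) (at t within {0..})"
    using t by (intro c0_semigroup_tendsto[OF S]) (auto simp: eventually_at_filter)
  moreover have "\<forall>\<^sub>F s in at t within {0..}. S (min s t) (q \<bar>s - t\<bar>) = (1 / (s - t)) *\<^sub>R (S s x - S t x)"
    unfolding eventually_at_filter
  proof (rule always_eventually, intro allI impI)
    fix s :: real assume s: "s \<noteq> t" "s \<in> {0..}"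
    show "S (min s t) (q \<bar>s - t\<bar>) = (1 / (s - t)) *\<^sub>R (S s x - S t x)"
    proof (cases "s < t")
      case True
      have "S t x = S s (S (t - s) x)" using c0_semigroup_add_apply[OF S, of s "t - s" x] s True by simp
      moreover have "(1 / (s - t)) *\<^sub>R (S s x - S t x) = (1 / (t - s)) *\<^sub>R (S t x - S s x)"
      proof -
        have "1 / (s - t) = - (1 / (t - s))" using True by (simp add: field_simps)
        then show ?thesis by (simp only: scaleR_minus_left scaleR_diff_right) simp
      qed
      ultimately show ?thesis using True
        by (simp add: q_def blinfun.diff_right blinfun.scaleR_right)
    next
      case False
      have "S s x = S t (S (s - t) x)" using c0_semigroup_add_apply[OF S, of t "s - t" x] t False by simp
      with False show ?thesis by (simp add: q_def blinfun.diff_right blinfun.scaleR_right)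
    qed
  qed
  ultimately show ?thesis
    unfolding has_vector_derivative_quotient by (rule Lim_transform_eventually)
qed

lemma semigroup_deviation_bound:
  assumes gen: "generates D A S" and x: "x \<in> D" and t: "0 \<le> t"
    and bd: "\<And>s. s \<in> {0..t} \<Longrightarrow> norm (S s) \<le> N"
  shows "norm (S t x - x) \<le> t * N * norm (A x)"
proof -
  have "((\<lambda>s. S s (A x)) has_integral (S t x - S 0 x)) {0..t}"
    using t by (intro fundamental_theorem_of_calculus)
      (auto intro: has_vector_derivative_within_subset[OF semigroup_orbit_derivative[OF gen x]])
  then have "norm (S t x - S 0 x) \<le> N * norm (A x) * t"
  proof (rule has_integral_norm_bound[OF t])
    show "norm (S s (A x)) \<le> N * norm (A x)" if "s \<in> {0..t}" for s
      using norm_blinfun[of "S s" "A x"] bd[OF that] by (meson mult_right_mono norm_ge_zero order_trans)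
  qed
  then show ?thesis by (simp add: c0_semigroup_zero[OF generates_c0[OF gen]] mult_ac)
qed

text \<open>The averages \<open>(1/h) \<integral>\<^sub>0\<^sup>h S(s)x ds\<close> lie in the domain, because applying \<open>S\<close> to them only shifts the
  interval of integration, and they converge to \<open>x\<close>.\<close>

lemma generator_domain_dense:
  assumes gen: "generates D A S"
  shows "closure D = UNIV"
proof -
  note S = generates_c0[OF gen]
  have "x \<in> closure D" for x
  proof -
    define G where "G t = integral {0..t} (\<lambda>s. blinfun_apply (S s) x)" for t
    have int: "(\<lambda>s. blinfun_apply (S s) x) integrable_on {a..b}" if "0 \<le> a" for a b
      using that by (intro integrable_continuous_real continuous_on_subset[OF c0_semigroup_continuous_orbit[OF S]]) auto
    have G: "((\<lambda>h. (1 / h) *\<^sub>R (G (t + h) - G t)) \<longlongrightarrow> S t x) (at_right 0)" if "0 \<le> t" for t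
    proof -
      have "(G has_vector_derivative S t x) (at t within {0..t + 1})"
        unfolding G_def using that
        by (intro integral_has_vector_derivative continuous_on_subset[OF c0_semigroup_continuous_orbit[OF S]]) auto
      then have "((\<lambda>s. (1 / (s - t)) *\<^sub>R (G s - G t)) \<longlongrightarrow> S t x) (at t within {0..t + 1})"
        by (simp add: has_vector_derivative_quotient)
      moreover have "filterlim (\<lambda>h. t + h) (at t within {0..t + 1}) (at_right 0)"
        unfolding filterlim_at
        using that by (auto intro!: tendsto_eq_intros eventually_at_rightI[of 0 1])
      ultimately have "((\<lambda>h. (1 / (t + h - t)) *\<^sub>R (G (t + h) - G t)) \<longlongrightarrow> S t x) (at_right 0)"
        by (rule filterlim_compose)
      then show ?thesis by simp
    qed
    have mem: "G \<tau> \<in> D" if \<tau>: "0 \<le> \<tau>" for \<tau>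
    proof -
      have shift: "S h (G \<tau>) = G (\<tau> + h) - G h" if "0 \<le> h" for h
      proof -
        have "S h (G \<tau>) = integral {0..\<tau>} (\<lambda>s. S h (S s x))"
          using integral_linear[OF int[of 0 \<tau>] blinfun.bounded_linear_right, of "S h"] by (simp add: G_def o_def)
        also have "\<dots> = integral {0..\<tau>} (\<lambda>s. S (s + h) x)"
          using that by (intro integral_cong) (simp add: c0_semigroup_add_apply[OF S, symmetric] add.commute)
        also have "\<dots> = integral {h..\<tau> + h} (\<lambda>s. S s x)"
          using integral_shift_real_ivl[of h h "\<tau> + h" "\<lambda>s. S s x"] by simp
        also have "\<dots> = G (\<tau> + h) - G h"
          using Henstock_Kurzweil_Integration.integral_combine[of 0 h "\<tau> + h", OF _ _ int] that \<tau>
          by (simp add: G_def algebra_simps)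
        finally show ?thesis .
      qed
      have "((\<lambda>h. (1 / h) *\<^sub>R (G (\<tau> + h) - G \<tau>) - (1 / h) *\<^sub>R (G (0 + h) - G 0)) \<longlongrightarrow> S \<tau> x - S 0 x) (at_right 0)"
        using \<tau> by (intro tendsto_diff G) auto
      moreover have "\<forall>\<^sub>F h in at_right 0. (1 / h) *\<^sub>R (G (\<tau> + h) - G \<tau>) - (1 / h) *\<^sub>R (G (0 + h) - G 0)
          = (1 / h) *\<^sub>R (S h (G \<tau>) - G \<tau>)"
        by (rule eventually_at_rightI[of 0 1]) (simp_all add: shift G_def[of 0] scaleR_diff_right)
      ultimately have "((\<lambda>h. (1 / h) *\<^sub>R (S h (G \<tau>) - G \<tau>)) \<longlongrightarrow> S \<tau> x - S 0 x) (at_right 0)"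
        by (rule Lim_transform_eventually)
      then show ?thesis using generates_iff[OF gen] by blast
    qed
    have "((\<lambda>h. (1 / h) *\<^sub>R G h) \<longlongrightarrow> x) (at_right 0)"
      using G[of 0] by (simp add: G_def[of 0] c0_semigroup_zero[OF S])
    moreover have "\<forall>\<^sub>F h in at_right 0. (1 / h) *\<^sub>R G h \<in> D"
      by (rule eventually_at_rightI[of 0 1]) (use mem generator_scaleR[OF gen] in auto)
    ultimately show ?thesis
      by (intro Lim_in_closed_set[of "closure D"])
        (auto elim!: eventually_mono intro: closure_subset[THEN subsetD])
  qed
  then show ?thesis by auto
qed

text \<open>Along a curve \<open>y\<close> in the domain, \<open>s \<mapsto> S(h - s) y(s)\<close> changes only by the defect
  \<open>y' - A y\<close>; integrating this gives variation of constants.\<close>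

lemma semigroup_reversed_derivative:
  assumes gen: "generates D A S" and s: "s \<in> {0..h}" and y: "y s \<in> D"
    and y': "(y has_vector_derivative y') (at s within {0..h})"
  shows "((\<lambda>r. blinfun_apply (S (h - r)) (y r)) has_vector_derivative S (h - s) (y' - A (y s))) (at s within {0..h})"
proof -
  note S = generates_c0[OF gen]
  have rev: "((\<lambda>r. blinfun_apply (S (h - r)) (y s)) has_vector_derivative - S (h - s) (A (y s))) (at s within {0..h})"
  proof -
    have "((\<lambda>t. S t (y s)) \<circ> (\<lambda>r. h - r) has_vector_derivative (- 1) *\<^sub>R S (h - s) (A (y s))) (at s within {0..h})"
    proof (rule vector_diff_chain_within)
      show "((\<lambda>r. h - r) has_vector_derivative - 1) (at s within {0..h})"
        by (auto intro!: derivative_eq_intros)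
      show "((\<lambda>t. S t (y s)) has_vector_derivative S (h - s) (A (y s))) (at (h - s) within (\<lambda>r. h - r) ` {0..h})"
        using s by (intro has_vector_derivative_within_subset[OF semigroup_orbit_derivative[OF gen y]]) auto
    qed
    then show ?thesis by (simp add: o_def)
  qed
  have "((\<lambda>r. S (h - r) ((1 / (r - s)) *\<^sub>R (y r - y s))) \<longlongrightarrow> S (h - s) y') (at s within {0..h})"
  proof (rule c0_semigroup_tendsto[OF S])
    show "((\<lambda>r. h - r) \<longlongrightarrow> h - s) (at s within {0..h})" by (intro tendsto_intros)
  qed (use s y' in \<open>auto simp: has_vector_derivative_quotient eventually_at_filter\<close>)
  from tendsto_add[OF this rev[unfolded has_vector_derivative_quotient]]
  show ?thesis
    unfolding has_vector_derivative_quotient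
    by (simp add: blinfun.scaleR_right blinfun.diff_right scaleR_diff_right)
qed

lemma variation_of_constants:
  assumes gen: "generates D A S" and h: "0 \<le> h"
    and y: "\<And>s. s \<in> {0..h} \<Longrightarrow> y s \<in> D"
    and y': "\<And>s. s \<in> {0..h} \<Longrightarrow> (y has_vector_derivative A (y s) + f s) (at s within {0..h})"
  shows "((\<lambda>s. blinfun_apply (S (h - s)) (f s)) has_integral (y h - S h (y 0))) {0..h}"
proof -
  have "((\<lambda>s. S (h - s) (f s)) has_integral (S (h - h) (y h) - S (h - 0) (y 0))) {0..h}"
  proof (rule fundamental_theorem_of_calculus[OF h])
    fix s assume s: "s \<in> {0..h}"
    show "((\<lambda>s. S (h - s) (y s)) has_vector_derivative S (h - s) (f s)) (at s within {0..h})"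
      using semigroup_reversed_derivative[OF gen s y[OF s] y'[OF s]] by simp
  qed
  then show ?thesis by (simp add: c0_semigroup_zero[OF generates_c0[OF gen]])
qed

text \<open>Variation of constants bounds the maximum of \<open>norm (E(s)x)\<close> over \<open>[0,h]\<close> by \<open>M norm x\<close> plus half of
  itself, for \<open>x\<close> in the domain; density of the domain gives the rest. The argument applies to every
  semigroup with the given generator, and the bound depends on \<open>M\<close> alone.\<close>

lemma perturbed_semigroup_bound:
  fixes B :: "'a::banach \<Rightarrow>\<^sub>L 'a"
  assumes gen: "generates D A S" and genE: "generates D (\<lambda>x. A x + B x) E" and h: "0 \<le> h"
    and bd: "\<And>t. t \<in> {0..h} \<Longrightarrow> norm (S t) \<le> M" and small: "M * norm B * h \<le> 1 / 2"
    and t: "t \<in> {0..h}"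
  shows "norm (E t) \<le> 2 * M"
proof -
  have M: "0 \<le> M" using bd[OF t] norm_ge_zero order_trans by blast
  have on_D: "norm (E t x) \<le> 2 * M * norm x" if x: "x \<in> D" for x
  proof -
    define y where "y s = blinfun_apply (E s) x" for s
    have y0: "y 0 = x" by (simp add: y_def c0_semigroup_zero[OF generates_c0[OF genE]])
    have yD: "y s \<in> D" if "0 \<le> s" for s
      using semigroup_generator_commute[OF genE x that] by (simp add: y_def)
    have y': "(y has_vector_derivative A (y s) + B (y s)) (at s within {0..})" if "0 \<le> s" for s
      using semigroup_orbit_derivative[OF genE x that] semigroup_generator_commute[OF genE x that]
      by (simp add: y_def[abs_def])
    have "continuous_on {0..h} (\<lambda>s. norm (y s))"
      unfolding y_def
      by (intro continuous_on_norm continuous_on_subset[OF c0_semigroup_continuous_orbit[OF generates_c0[OF genE]]]) auto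
    then obtain p where p: "p \<in> {0..h}" "\<And>s. s \<in> {0..h} \<Longrightarrow> norm (y s) \<le> norm (y p)"
      using continuous_attains_sup[of "{0..h}" "\<lambda>s. norm (y s)"] h by auto
    have "((\<lambda>s. S (p - s) (B (y s))) has_integral (y p - S p (y 0))) {0..p}"
      using p(1) by (intro variation_of_constants[OF gen])
        (auto intro: yD has_vector_derivative_within_subset[OF y'])
    then have "norm (y p - S p (y 0)) \<le> M * (norm B * norm (y p)) * p"
    proof (rule has_integral_norm_bound[rotated])
      fix s assume s: "s \<in> {0..p}"
      have "norm (S (p - s) (B (y s))) \<le> norm (S (p - s)) * (norm B * norm (y s))"
        using norm_blinfun[of "S (p - s)" "B (y s)"] norm_blinfun[of B "y s"]
        by (meson mult_left_mono norm_ge_zero order_trans)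
      also have "\<dots> \<le> M * (norm B * norm (y p))"
        using s p bd[of "p - s"] M by (intro mult_mono mult_left_mono) auto
      finally show "norm (S (p - s) (B (y s))) \<le> M * (norm B * norm (y p))" .
    qed (use p in auto)
    also have "\<dots> = (M * norm B * p) * norm (y p)" by simp
    also have "\<dots> \<le> (M * norm B * h) * norm (y p)"
      using p M by (intro mult_right_mono mult_left_mono) auto
    also have "\<dots> \<le> 1 / 2 * norm (y p)" using small by (intro mult_right_mono) auto
    finally have "norm (y p - S p x) \<le> 1 / 2 * norm (y p)" by (simp add: y0)
    moreover have "norm (S p x) \<le> M * norm x"
      using norm_blinfun[of "S p" x] bd[OF p(1)] by (meson mult_right_mono norm_ge_zero order_trans)
    moreover have "norm (y p) \<le> norm (y p - S p x) + norm (S p x)"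
      using norm_triangle_ineq[of "y p - S p x" "S p x"] by simp
    ultimately have "norm (y p) \<le> 2 * (M * norm x)" by linarith
    with p(2)[OF t] show ?thesis by (simp add: y_def)
  qed
  have "closed {x. norm (E t x) \<le> 2 * M * norm x}"
    by (intro closed_Collect_le continuous_intros)
  then have "closure D \<subseteq> {x. norm (E t x) \<le> 2 * M * norm x}"
    using on_D by (intro closure_minimal) auto
  then show ?thesis
    using M by (intro norm_blinfun_bound) (auto simp: generator_domain_dense[OF gen])
qed

section \<open>Bounded perturbation of generators\<close>

text \<open>Multiplication by a scalar exponential lets one assume that a semigroup decays as fast as desired.\<close>

lemma generates_rescale:
  fixes A :: "'a::banach \<Rightarrow> 'a"
  assumes gen: "generates D A S"
  shows "generates D (\<lambda>x. A x + \<kappa> *\<^sub>R x) (\<lambda>t. exp (\<kappa> * t) *\<^sub>R S t)"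
proof -
  note S = generates_c0[OF gen]
  have exp0: "((\<lambda>t. exp (\<mu> * t)) \<longlongrightarrow> 1) (at_right 0)" for \<mu> :: real
    by (rule tendsto_eq_intros refl | simp)+
  have quot: "((\<lambda>t. (1 / t) * (exp (\<mu> * t) - 1)) \<longlongrightarrow> \<mu>) (at_right 0)" for \<mu> :: real
  proof -
    have "((\<lambda>t. exp (\<mu> * t)) has_vector_derivative \<mu>) (at 0 within {0<..})"
      by (auto intro!: derivative_eq_intros
          simp: has_real_derivative_iff_has_vector_derivative[symmetric])
    then show ?thesis by (simp add: has_vector_derivative_quotient)
  qed
  \<comment> \<open>Both directions of the domain condition are this one implication, for \<open>\<kappa>\<close> and for \<open>-\<kappa>\<close>.\<close>
  have transfer: "((\<lambda>h. (1 / h) *\<^sub>R (exp (\<mu> * h) *\<^sub>R F h - x)) \<longlongrightarrow> y + \<mu> *\<^sub>R x) (at_right 0)"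
    if "((\<lambda>h. (1 / h) *\<^sub>R (F h - x)) \<longlongrightarrow> y) (at_right 0)" for \<mu> and F :: "real \<Rightarrow> 'a" and x y
  proof -
    have "((\<lambda>h. exp (\<mu> * h) *\<^sub>R ((1 / h) *\<^sub>R (F h - x)) + ((1 / h) * (exp (\<mu> * h) - 1)) *\<^sub>R x)
        \<longlongrightarrow> 1 *\<^sub>R y + \<mu> *\<^sub>R x) (at_right 0)"
      by (intro tendsto_add tendsto_scaleR that exp0 quot tendsto_const)
    then show ?thesis by (simp add: algebra_simps)
  qed
  have "c0_semigroup (\<lambda>t. exp (\<kappa> * t) *\<^sub>R S t)"
    unfolding c0_semigroup_def
  proof (intro conjI allI impI)
    show "exp (\<kappa> * 0) *\<^sub>R S 0 = id_blinfun" by (simp add: c0_semigroup_zero[OF S])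
    fix s t :: real assume "0 \<le> s" "0 \<le> t"
    then show "exp (\<kappa> * (s + t)) *\<^sub>R S (s + t) = (exp (\<kappa> * s) *\<^sub>R S s) o\<^sub>L (exp (\<kappa> * t) *\<^sub>R S t)"
      by (intro blinfun_eqI)
        (simp add: c0_semigroup_add[OF S] blinfun.scaleR_left blinfun.scaleR_right distrib_left exp_add)
  next
    fix x
    show "((\<lambda>t. (exp (\<kappa> * t) *\<^sub>R S t) x) \<longlongrightarrow> x) (at_right 0)"
      using tendsto_scaleR[OF exp0[of \<kappa>] c0_semigroup_at_zero[OF S, of x]] by (simp add: blinfun.scaleR_left)
  qed
  moreover have "x \<in> D \<and> A x + \<kappa> *\<^sub>R x = y \<longleftrightarrow>
      ((\<lambda>h. (1 / h) *\<^sub>R ((exp (\<kappa> * h) *\<^sub>R S h) x - x)) \<longlongrightarrow> y) (at_right 0)" for x y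
  proof -
    have "x \<in> D \<and> A x + \<kappa> *\<^sub>R x = y \<longleftrightarrow> x \<in> D \<and> A x = y - \<kappa> *\<^sub>R x"
      by (auto simp: algebra_simps)
    also have "\<dots> \<longleftrightarrow> ((\<lambda>h. (1 / h) *\<^sub>R (S h x - x)) \<longlongrightarrow> y - \<kappa> *\<^sub>R x) (at_right 0)"
      by (rule generates_iff[OF gen])
    also have "\<dots> \<longleftrightarrow> ((\<lambda>h. (1 / h) *\<^sub>R (exp (\<kappa> * h) *\<^sub>R S h x - x)) \<longlongrightarrow> y) (at_right 0)"
      using transfer[of "\<lambda>h. S h x" x "y - \<kappa> *\<^sub>R x" \<kappa>]
        transfer[of "\<lambda>h. exp (\<kappa> * h) *\<^sub>R S h x" x y "- \<kappa>"]
      by (auto simp flip: exp_add)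
    finally show ?thesis by (simp add: blinfun.scaleR_left)
  qed
  ultimately show ?thesis unfolding generates_def by blast
qed

text \<open>For a semigroup that decays fast enough compared with the perturbation, the convolution with
  \<open>S\<close> composed with \<open>B\<close> halves the supremum norm on the whole half-line. This makes the
  integral equation for the perturbed orbits a contraction, without any restriction to short times.\<close>

context
  fixes S :: "real \<Rightarrow> 'a::banach \<Rightarrow>\<^sub>L 'a" and B :: "'a \<Rightarrow>\<^sub>L 'a" and N \<delta> :: real
  assumes S: "c0_semigroup S"
    and decay: "\<And>t. 0 \<le> t \<Longrightarrow> norm (S t) \<le> N * exp (- \<delta> * t)"
    and \<delta>: "0 < \<delta>" and NB: "N * norm B \<le> \<delta> / 2"
begin

lemma decay_constant_nonneg: "0 \<le> N"
  using decay[of 0] order_trans[OF norm_ge_zero] by simp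

lemma perturbation_convolution_bound:
  assumes w: "continuous_on {0..} w" and W: "\<And>s. 0 \<le> s \<Longrightarrow> norm (w s) \<le> W" and t: "0 \<le> t"
  shows "norm (integral {0..t} (\<lambda>r. S (t - r) (B (w r)))) \<le> W / 2"
proof -
  have W0: "0 \<le> W" using W[of 0] norm_ge_zero order_trans by blast
  have "((\<lambda>r. N * norm B * W * exp (- \<delta> * (t - r))) has_integral
      N * norm B * W * (exp (- \<delta> * (t - t)) / \<delta> - exp (- \<delta> * (t - 0)) / \<delta>)) {0..t}"
    using t \<delta>
    by (intro has_integral_mult_right fundamental_theorem_of_calculus)
      (auto intro!: derivative_eq_intros
        simp: has_real_derivative_iff_has_vector_derivative[symmetric])
  note maj = this
  have cont: "continuous_on {0..t} (\<lambda>r. blinfun_apply B (w r))"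
    by (intro continuous_intros continuous_on_subset[OF w]) auto
  have "norm (integral {0..t} (\<lambda>r. S (t - r) (B (w r)))) \<le>
      integral {0..t} (\<lambda>r. N * norm B * W * exp (- \<delta> * (t - r)))"
  proof (rule integral_norm_bound_integral[OF convolution_integrable[OF S cont] has_integral_integrable[OF maj]])
    fix r assume r: "r \<in> {0..t}"
    have "norm (S (t - r) (B (w r))) \<le> norm (S (t - r)) * (norm B * norm (w r))"
      using norm_blinfun[of "S (t - r)" "B (w r)"] norm_blinfun[of B "w r"]
      by (meson mult_left_mono norm_ge_zero order_trans)
    also have "\<dots> \<le> (N * exp (- \<delta> * (t - r))) * (norm B * W)"
      using r decay[of "t - r"] W[of r] decay_constant_nonneg by (intro mult_mono mult_left_mono) auto
    finally show "norm (S (t - r) (B (w r))) \<le> N * norm B * W * exp (- \<delta> * (t - r))"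
      by (simp add: mult_ac)
  qed
  also have "\<dots> = N * norm B * W * (1 / \<delta> - exp (- \<delta> * t) / \<delta>)"
    using integral_unique[OF maj] by simp
  also have "\<dots> \<le> N * norm B * W * (1 / \<delta>)"
    using decay_constant_nonneg W0 \<delta> by (intro mult_left_mono) auto
  also have "\<dots> \<le> (\<delta> / 2) * W * (1 / \<delta>)"
    using NB W0 \<delta> by (intro mult_right_mono) auto
  also have "\<dots> = W / 2" using \<delta> by simp
  finally show ?thesis .
qed

text \<open>Boundedness is part of the definition because it makes the supremum norm available, in which
  the convolution estimate gives uniqueness at once.\<close>

definition mild_orbit :: "'a \<Rightarrow> (real \<Rightarrow> 'a) \<Rightarrow> bool" where
  "mild_orbit x w \<longleftrightarrow> continuous_on {0..} w \<and> (\<exists>W. \<forall>t\<ge>0. norm (w t) \<le> W) \<and>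
    (\<forall>t\<ge>0. w t = S t x + integral {0..t} (\<lambda>r. S (t - r) (B (w r))))"

lemma mild_orbit_continuous: "mild_orbit x w \<Longrightarrow> continuous_on {0..} w"
  unfolding mild_orbit_def by blast

lemma mild_orbit_bounded: "mild_orbit x w \<Longrightarrow> \<exists>W. \<forall>t\<ge>0. norm (w t) \<le> W"
  unfolding mild_orbit_def by blast

lemma mild_orbit_eq:
  "mild_orbit x w \<Longrightarrow> 0 \<le> t \<Longrightarrow> w t = S t x + integral {0..t} (\<lambda>r. S (t - r) (B (w r)))"
  unfolding mild_orbit_def by blast

lemma convolution_B_integrable:
  assumes "continuous_on {0..} w"
  shows "(\<lambda>r. S (t - r) (B (w r))) integrable_on {0..t}"
  by (intro convolution_integrable[OF S] continuous_intros continuous_on_subset[OF assms]) auto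

lemma mild_orbit_exists: "\<exists>w. mild_orbit x w"
proof -
  define \<Phi> where "\<Phi> v t = S \<bar>t\<bar> x + integral {0..\<bar>t\<bar>} (\<lambda>r. S (\<bar>t\<bar> - r) (B (apply_bcontfun v r)))"
    for v :: "real \<Rightarrow>\<^sub>C 'a" and t :: real
  have conv_bound: "norm (integral {0..\<bar>t\<bar>} (\<lambda>r. S (\<bar>t\<bar> - r) (B (apply_bcontfun v r)))) \<le> norm v / 2"
    for v :: "real \<Rightarrow>\<^sub>C 'a" and t :: real
    by (rule perturbation_convolution_bound) (auto intro: norm_bounded)
  have "\<Phi> v \<in> bcontfun" for v
  proof (rule bcontfun_normI)
    have "continuous_on UNIV (\<lambda>t. integral {0..\<bar>t\<bar>} (\<lambda>r. S (\<bar>t\<bar> - r) (B (apply_bcontfun v r))))"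
      by (rule continuous_on_compose2[OF convolution_continuous[OF S, of "\<lambda>r. B (apply_bcontfun v r)"]])
        (auto intro!: continuous_intros)
    then show "continuous_on UNIV (\<Phi> v)"
      unfolding \<Phi>_def by (intro continuous_intros c0_semigroup_continuous_on[OF S]) auto
    fix t
    have "norm (S \<bar>t\<bar> x) \<le> N * norm x"
    proof -
      have "norm (S \<bar>t\<bar>) \<le> N"
        using decay[of "\<bar>t\<bar>"] decay_constant_nonneg \<delta> mult_left_le[of "exp (- \<delta> * \<bar>t\<bar>)" N] by simp
      then show ?thesis using norm_blinfun[of "S \<bar>t\<bar>" x] by (meson mult_right_mono norm_ge_zero order_trans)
    qed
    then show "norm (\<Phi> v t) \<le> N * norm x + norm v / 2"
      unfolding \<Phi>_def using conv_bound[of t v] by (intro norm_triangle_le add_mono)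
  qed
  then have app: "apply_bcontfun (Bcontfun (\<Phi> v)) = \<Phi> v" for v by (rule Bcontfun_inverse)
  have "\<exists>!v. Bcontfun (\<Phi> v) = v"
  proof (rule banach_fix_type)
    show "\<forall>v w. dist (Bcontfun (\<Phi> v)) (Bcontfun (\<Phi> w)) \<le> 1 / 2 * dist v w"
    proof (intro allI dist_bound)
      fix v w :: "real \<Rightarrow>\<^sub>C 'a" and t :: real
      have "\<Phi> v t - \<Phi> w t = integral {0..\<bar>t\<bar>} (\<lambda>r. S (\<bar>t\<bar> - r) (B (apply_bcontfun (v - w) r)))"
        by (simp add: \<Phi>_def blinfun.diff_right integral_diff convolution_B_integrable)
      then have "norm (\<Phi> v t - \<Phi> w t) \<le> norm (v - w) / 2" by (simp only: conv_bound)
      then show "dist (apply_bcontfun (Bcontfun (\<Phi> v)) t) (apply_bcontfun (Bcontfun (\<Phi> w)) t) \<le> 1 / 2 * dist v w"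
        by (simp add: app dist_norm)
    qed
  qed auto
  then obtain v where "Bcontfun (\<Phi> v) = v" by blast
  with app have fixp: "apply_bcontfun v t = \<Phi> v t" for t by metis
  have "apply_bcontfun v t = S t x + integral {0..t} (\<lambda>r. S (t - r) (B (apply_bcontfun v r)))" if "0 \<le> t" for t
    using fixp[of t] that by (simp add: \<Phi>_def)
  moreover have "\<exists>W. \<forall>t\<ge>0. norm (apply_bcontfun v t) \<le> W" using norm_bounded by blast
  moreover have "continuous_on {0..} (apply_bcontfun v)" by simp
  ultimately have "mild_orbit x (apply_bcontfun v)" unfolding mild_orbit_def by blast
  then show ?thesis by blast
qed

lemma mild_orbit_add:
  assumes v: "mild_orbit x v" and w: "mild_orbit y w"
  shows "mild_orbit (x + y) (\<lambda>t. v t + w t)"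
  unfolding mild_orbit_def
proof (intro conjI allI impI)
  note cont = mild_orbit_continuous[OF v] mild_orbit_continuous[OF w]
  show "continuous_on {0..} (\<lambda>t. v t + w t)" by (intro continuous_on_add cont)
  obtain V W where "\<forall>t\<ge>0. norm (v t) \<le> V" "\<forall>t\<ge>0. norm (w t) \<le> W"
    using mild_orbit_bounded[OF v] mild_orbit_bounded[OF w] by blast
  then show "\<exists>W. \<forall>t\<ge>0. norm (v t + w t) \<le> W"
    by (intro exI[of _ "V + W"]) (auto intro: norm_triangle_le add_mono)
  fix t :: real assume t: "0 \<le> t"
  show "v t + w t = S t (x + y) + integral {0..t} (\<lambda>r. S (t - r) (B (v r + w r)))"
    unfolding mild_orbit_eq[OF v t] mild_orbit_eq[OF w t]
    by (simp add: blinfun.add_right integral_add convolution_B_integrable cont)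
qed

lemma mild_orbit_scaleR:
  assumes w: "mild_orbit x w"
  shows "mild_orbit (c *\<^sub>R x) (\<lambda>t. c *\<^sub>R w t)"
  unfolding mild_orbit_def
proof (intro conjI allI impI)
  show "continuous_on {0..} (\<lambda>t. c *\<^sub>R w t)"
    by (intro continuous_on_scaleR continuous_on_const mild_orbit_continuous[OF w])
  obtain W where "\<forall>t\<ge>0. norm (w t) \<le> W" using mild_orbit_bounded[OF w] by blast
  then show "\<exists>W. \<forall>t\<ge>0. norm (c *\<^sub>R w t) \<le> W"
    by (intro exI[of _ "\<bar>c\<bar> * W"]) (auto intro: mult_left_mono)
  fix t :: real assume t: "0 \<le> t"
  show "c *\<^sub>R w t = S t (c *\<^sub>R x) + integral {0..t} (\<lambda>r. S (t - r) (B (c *\<^sub>R w r)))"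
    unfolding mild_orbit_eq[OF w t] by (simp add: blinfun.scaleR_right scaleR_add_right)
qed

lemma mild_orbit_bound:
  assumes "mild_orbit x w" "0 \<le> t"
  shows "norm (w t) \<le> 2 * N * norm x"
proof -
  define W where "W = (SUP t\<in>{0..}. norm (w t))"
  have bdd: "bdd_above ((\<lambda>t. norm (w t)) ` {0..})"
  proof -
    obtain C where "\<forall>t\<ge>0. norm (w t) \<le> C" using mild_orbit_bounded[OF assms(1)] by blast
    then show ?thesis by (intro bdd_aboveI2[of _ _ C]) auto
  qed
  then have le_W: "norm (w s) \<le> W" if "0 \<le> s" for s
    unfolding W_def using that by (intro cSUP_upper) auto
  have "norm (w s) \<le> N * norm x + W / 2" if "0 \<le> s" for s
  proof -
    have "norm (S s x) \<le> N * norm x"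
    proof -
      have "norm (S s) \<le> N"
        using decay[OF that] decay_constant_nonneg \<delta> that mult_left_le[of "exp (- \<delta> * s)" N] by simp
      then show ?thesis using norm_blinfun[of "S s" x] by (meson mult_right_mono norm_ge_zero order_trans)
    qed
    moreover have "norm (integral {0..s} (\<lambda>r. S (s - r) (B (w r)))) \<le> W / 2"
      by (intro perturbation_convolution_bound mild_orbit_continuous[OF assms(1)] le_W that)
    ultimately show ?thesis
      unfolding mild_orbit_eq[OF assms(1) that] by (intro norm_triangle_le add_mono)
  qed
  then have "W \<le> N * norm x + W / 2" unfolding W_def by (intro cSUP_least) auto
  with le_W[OF assms(2)] show ?thesis by simp
qed

text \<open>The difference of two mild orbits is a mild orbit that starts at \<open>0\<close>.\<close>

lemma mild_orbit_unique:
  assumes "mild_orbit x v" "mild_orbit x w" "0 \<le> t"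
  shows "v t = w t"
proof -
  have "mild_orbit (x + (- 1) *\<^sub>R x) (\<lambda>t. v t + (- 1) *\<^sub>R w t)"
    by (intro mild_orbit_add mild_orbit_scaleR assms)
  from mild_orbit_bound[OF this assms(3)] show ?thesis by simp
qed

text \<open>Together with uniqueness this is the semigroup law for the perturbed orbits.\<close>

lemma mild_orbit_shift:
  assumes w: "mild_orbit x w" and s: "0 \<le> s"
  shows "mild_orbit (w s) (\<lambda>t. w (s + t))"
  unfolding mild_orbit_def
proof (intro conjI allI impI)
  note cont = mild_orbit_continuous[OF w] and eq = mild_orbit_eq[OF w]
  show "continuous_on {0..} (\<lambda>t. w (s + t))"
    using s by (intro continuous_on_compose2[OF cont] continuous_intros) auto
  obtain W where "\<forall>t\<ge>0. norm (w t) \<le> W" using mild_orbit_bounded[OF w] by blast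
  then show "\<exists>W. \<forall>t\<ge>0. norm (w (s + t)) \<le> W" using s by (intro exI[of _ W]) auto
  fix t :: real assume t: "0 \<le> t"
  have contB: "continuous_on {0..} (\<lambda>r. blinfun_apply B (w r))"
    by (intro continuous_intros cont)
  have "w (s + t) = S (t + s) x + integral {0..s + t} (\<lambda>r. S (s + t - r) (B (w r)))"
    using eq[of "s + t"] s t by (simp add: add.commute)
  also have "\<dots> = S t (S s x + integral {0..s} (\<lambda>r. S (s - r) (B (w r))))
      + integral {0..t} (\<lambda>r. S (t - r) (B (w (s + r))))"
    by (simp add: convolution_split[OF S contB s t] c0_semigroup_add_apply[OF S t s] blinfun.add_right)
  finally show "w (s + t) = S t (w s) + integral {0..t} (\<lambda>r. S (t - r) (B (w (s + r))))"
    using eq[OF s] by simp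
qed

text \<open>For \<open>t \<ge> 0\<close> all choices of the mild orbit agree; at negative times the value is arbitrary.\<close>

definition perturbed_semigroup :: "real \<Rightarrow> 'a \<Rightarrow>\<^sub>L 'a" where
  "perturbed_semigroup t = Blinfun (\<lambda>x. (SOME w. mild_orbit x w) t)"

lemma perturbed_semigroup_eqI:
  assumes t: "0 \<le> t" and w: "mild_orbit x w"
  shows "perturbed_semigroup t x = w t"
proof -
  define v where "v x = (SOME w. mild_orbit x w)" for x
  have v: "mild_orbit x (v x)" for x
    unfolding v_def using mild_orbit_exists by (rule someI_ex)
  have "bounded_linear (\<lambda>x. v x t)"
  proof (rule bounded_linear_intro[where K = "2 * N"])
    show "v (x + y) t = v x t + v y t" for x y
      by (rule mild_orbit_unique[OF v mild_orbit_add[OF v v] t])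
    show "v (c *\<^sub>R x) t = c *\<^sub>R v x t" for c x
      by (rule mild_orbit_unique[OF v mild_orbit_scaleR[OF v] t])
    show "norm (v x t) \<le> norm x * (2 * N)" for x
      using mild_orbit_bound[OF v t] by (simp add: mult.commute)
  qed
  then have "perturbed_semigroup t x = v x t"
    unfolding perturbed_semigroup_def v_def by (simp add: bounded_linear_Blinfun_apply)
  also have "\<dots> = w t" by (rule mild_orbit_unique[OF v w t])
  finally show ?thesis .
qed

text \<open>The convolution term has the right derivative \<open>B x\<close> at \<open>0\<close> for every \<open>x\<close>, so the difference quotients of
  the two semigroups converge for the same \<open>x\<close>: the domain does not change.\<close>

lemma perturbed_semigroup_generates:
  assumes gen: "generates D A S"
  shows "generates D (\<lambda>x. A x + B x) perturbed_semigroup"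
proof -
  have at0: "w 0 = x" if "mild_orbit x w" for x w
    using mild_orbit_eq[OF that, of 0] by (simp add: c0_semigroup_zero[OF S])
  have "c0_semigroup perturbed_semigroup"
    unfolding c0_semigroup_def
  proof (intro conjI allI impI)
    show "perturbed_semigroup 0 = id_blinfun"
      using at0 mild_orbit_exists by (intro blinfun_eqI) (metis blinfun_apply_id_blinfun id_apply order_refl perturbed_semigroup_eqI)
    show "perturbed_semigroup (s + t) = perturbed_semigroup s o\<^sub>L perturbed_semigroup t"
      if st: "0 \<le> s" "0 \<le> t" for s t
    proof (rule blinfun_eqI)
      fix x
      obtain w where w: "mild_orbit x w" using mild_orbit_exists by blast
      have "perturbed_semigroup s (w t) = w (t + s)"
        using perturbed_semigroup_eqI[OF st(1) mild_orbit_shift[OF w st(2)]] .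
      then show "perturbed_semigroup (s + t) x = (perturbed_semigroup s o\<^sub>L perturbed_semigroup t) x"
        using st w by (simp add: perturbed_semigroup_eqI add.commute)
    qed
    fix x
    obtain w where w: "mild_orbit x w" using mild_orbit_exists by blast
    then have "(w \<longlongrightarrow> w 0) (at 0 within {0..})" 
      using mild_orbit_continuous unfolding continuous_on_def by (metis atLeast_iff order_refl)
    then have "(w \<longlongrightarrow> x) (at_right 0)" by (simp add: at0[OF w] at_within_Ici_at_right)
    moreover have "\<forall>\<^sub>F t in at_right 0. w t = perturbed_semigroup t x"
      by (rule eventually_at_rightI[of 0 1]) (use w in \<open>auto simp: perturbed_semigroup_eqI\<close>)
    ultimately show "((\<lambda>t. perturbed_semigroup t x) \<longlongrightarrow> x) (at_right 0)"
      by (rule Lim_transform_eventually)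
  qed
  moreover have "x \<in> D \<and> A x + B x = y \<longleftrightarrow>
      ((\<lambda>h. (1 / h) *\<^sub>R (perturbed_semigroup h x - x)) \<longlongrightarrow> y) (at_right 0)" for x y
  proof -
    obtain w where w: "mild_orbit x w" using mild_orbit_exists by blast
    have contB: "continuous_on {0..} (\<lambda>r. blinfun_apply B (w r))"
      by (intro continuous_intros mild_orbit_continuous[OF w])
    let ?q = "\<lambda>h. (1 / h) *\<^sub>R (S h x - x)"
    let ?c = "\<lambda>h. (1 / h) *\<^sub>R integral {0..h} (\<lambda>r. S (h - r) (B (w r)))"
    have c: "(?c \<longlongrightarrow> B x) (at_right 0)"
      using convolution_quotient[OF S contB] by (simp add: at0[OF w])
    have "x \<in> D \<and> A x + B x = y \<longleftrightarrow> x \<in> D \<and> A x = y - B x" by (auto simp: algebra_simps)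
    also have "\<dots> \<longleftrightarrow> (?q \<longlongrightarrow> y - B x) (at_right 0)" by (rule generates_iff[OF gen])
    also have "\<dots> \<longleftrightarrow> ((\<lambda>h. ?q h + ?c h) \<longlongrightarrow> y) (at_right 0)"
      using tendsto_add[OF _ c, of ?q "y - B x"] tendsto_diff[OF _ c, of "\<lambda>h. ?q h + ?c h" y] by auto
    also have "\<dots> \<longleftrightarrow> ((\<lambda>h. (1 / h) *\<^sub>R (perturbed_semigroup h x - x)) \<longlongrightarrow> y) (at_right 0)"
    proof (rule tendsto_cong)
      show "\<forall>\<^sub>F h in at_right 0. ?q h + ?c h = (1 / h) *\<^sub>R (perturbed_semigroup h x - x)"
      proof (rule eventually_at_rightI[of 0 1])
        fix h :: real assume "h \<in> {0<..<1}"
        then have "perturbed_semigroup h x = S h x + integral {0..h} (\<lambda>r. S (h - r) (B (w r)))"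
          using perturbed_semigroup_eqI[OF _ w, of h] mild_orbit_eq[OF w, of h] by simp
        then show "?q h + ?c h = (1 / h) *\<^sub>R (perturbed_semigroup h x - x)"
          by (simp add: algebra_simps)
      qed simp
    qed
    finally show ?thesis .
  qed
  ultimately show ?thesis unfolding generates_def by blast
qed

end

text \<open>The growth of an arbitrary semigroup is first compensated by a shift of the generator, which is
  undone at the end.\<close>

theorem bounded_perturbation:
  fixes A :: "'a::banach \<Rightarrow> 'a" and B :: "'a \<Rightarrow>\<^sub>L 'a"
  assumes "is_generator D A"
  shows "is_generator D (\<lambda>x. A x + B x)"
proof -
  obtain S where gen: "generates D A S" using assms by (auto simp: is_generator_def)
  obtain N \<omega> where growth: "1 \<le> N" "0 \<le> \<omega>" "\<And>t. 0 \<le> t \<Longrightarrow> norm (S t) \<le> N * exp (\<omega> * t)"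
    using c0_semigroup_growth[OF generates_c0[OF gen]] by blast
  define \<delta> where "\<delta> = 2 * N * norm B + 1"
  define \<kappa> where "\<kappa> = - (\<omega> + \<delta>)"
  let ?S = "\<lambda>t. exp (\<kappa> * t) *\<^sub>R S t"
  have gen': "generates D (\<lambda>x. A x + \<kappa> *\<^sub>R x) ?S" by (rule generates_rescale[OF gen])
  have "norm (?S t) \<le> N * exp (- \<delta> * t)" if "0 \<le> t" for t
  proof -
    have "norm (?S t) = exp (\<kappa> * t) * norm (S t)" by simp
    also have "\<dots> \<le> exp (\<kappa> * t) * (N * exp (\<omega> * t))"
      by (intro mult_left_mono growth(3) that) simp
    also have "\<dots> = N * exp (\<kappa> * t + \<omega> * t)" by (simp add: exp_add)
    also have "\<kappa> * t + \<omega> * t = - \<delta> * t" by (simp add: \<kappa>_def algebra_simps)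
    finally show ?thesis .
  qed
  moreover have "0 < \<delta>" "N * norm B \<le> \<delta> / 2" using growth(1) by (auto simp: \<delta>_def add_nonneg_pos)
  ultimately have "generates D (\<lambda>x. (A x + \<kappa> *\<^sub>R x) + B x) (perturbed_semigroup ?S B)"
    using perturbed_semigroup_generates[OF generates_c0[OF gen'] _ _ _ gen'] by blast
  from generates_rescale[OF this, of "- \<kappa>"] show ?thesis
    by (auto simp: is_generator_def algebra_simps)
qed

section \<open>Taylor bounds and the symmetry of the second derivative\<close>

lemma vector_mean_value_bound:
  fixes f :: "real \<Rightarrow> 'a::banach"
  assumes "0 \<le> h"
    and "\<And>s. s \<in> {0..h} \<Longrightarrow> (f has_vector_derivative f' s) (at s within {0..h})"
    and "\<And>s. s \<in> {0..h} \<Longrightarrow> norm (f' s) \<le> c"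
  shows "norm (f h - f 0) \<le> c * h"
  using assms by (intro has_integral_norm_bound fundamental_theorem_of_calculus)

lemma power_bound_integrates:
  fixes r :: "real \<Rightarrow> 'a::banach"
  assumes r': "\<And>s. s \<in> {0..h} \<Longrightarrow> (r has_vector_derivative r' s) (at s within {0..h})"
    and bd: "\<And>s. s \<in> {0..h} \<Longrightarrow> norm (r' s) \<le> c * s ^ k"
    and c: "0 \<le> c" and r0: "r 0 = 0" and s: "s \<in> {0..h}"
  shows "norm (r s) \<le> c * s ^ Suc k"
proof -
  have "norm (r s - r 0) \<le> c * s ^ k * s"
  proof (rule vector_mean_value_bound)
    fix t assume t: "t \<in> {0..s}"
    show "(r has_vector_derivative r' t) (at t within {0..s})"
      using r'[of t] s t by (auto intro: has_vector_derivative_within_subset)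
    have "norm (r' t) \<le> c * t ^ k" using bd t s by auto
    also have "\<dots> \<le> c * s ^ k" using t c by (intro mult_left_mono power_mono) auto
    finally show "norm (r' t) \<le> c * s ^ k" .
  qed (use s in auto)
  then show ?thesis by (simp add: r0 mult_ac)
qed

text \<open>The Taylor remainder is estimated by integrating the bound on the fourth derivative four
  times; the factor \<open>1/24\<close> is given away.\<close>

lemma taylor_quartic_remainder:
  fixes f :: "real \<Rightarrow> 'a::banach"
  assumes f: "\<And>s. s \<in> {0..h} \<Longrightarrow> (f has_vector_derivative f1 s) (at s within {0..h})"
    and f1: "\<And>s. s \<in> {0..h} \<Longrightarrow> (f1 has_vector_derivative f2 s) (at s within {0..h})"
    and f2: "\<And>s. s \<in> {0..h} \<Longrightarrow> (f2 has_vector_derivative f3 s) (at s within {0..h})"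
    and f3: "\<And>s. s \<in> {0..h} \<Longrightarrow> (f3 has_vector_derivative f4 s) (at s within {0..h})"
    and f4: "\<And>s. s \<in> {0..h} \<Longrightarrow> norm (f4 s) \<le> c"
    and zero: "f 0 = 0" "f1 0 = 0" and s: "s \<in> {0..h}"
  shows "norm (f s - (s\<^sup>2 / 2) *\<^sub>R f2 0 - (s ^ 3 / 6) *\<^sub>R f3 0) \<le> c * s ^ 4"
proof -
  have c: "0 \<le> c" using order_trans[OF norm_ge_zero f4[OF s]] .
  have r3: "norm (f3 s - f3 0) \<le> c * s ^ Suc 0" if "s \<in> {0..h}" for s
  proof (rule power_bound_integrates[OF _ _ c _ that])
    show "((\<lambda>s. f3 s - f3 0) has_vector_derivative f4 s) (at s within {0..h})" if "s \<in> {0..h}" for s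
      using has_vector_derivative_diff[OF f3[OF that] has_vector_derivative_const] by simp
  qed (use f4 in auto)
  have r2: "norm (f2 s - f2 0 - s *\<^sub>R f3 0) \<le> c * s ^ Suc (Suc 0)" if "s \<in> {0..h}" for s
  proof (rule power_bound_integrates[OF _ r3 c _ that])
    show "((\<lambda>s. f2 s - f2 0 - s *\<^sub>R f3 0) has_vector_derivative f3 s - f3 0) (at s within {0..h})" if "s \<in> {0..h}" for s
      by (auto intro!: derivative_eq_intros f2[OF that])
  qed auto
  have r1: "norm (f1 s - s *\<^sub>R f2 0 - (s ^ 2 / 2) *\<^sub>R f3 0) \<le> c * s ^ Suc (Suc (Suc 0))" if "s \<in> {0..h}" for s
  proof (rule power_bound_integrates[OF _ r2 c _ that])
    show "((\<lambda>s. f1 s - s *\<^sub>R f2 0 - (s ^ 2 / 2) *\<^sub>R f3 0) has_vector_derivative f2 s - f2 0 - s *\<^sub>R f3 0) (at s within {0..h})" if "s \<in> {0..h}" for s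
      by (auto intro!: derivative_eq_intros f1[OF that])
  qed (use zero in auto)
  have "norm (f s - (s ^ 2 / 2) *\<^sub>R f2 0 - (s ^ 3 / 6) *\<^sub>R f3 0) \<le> c * s ^ Suc (Suc (Suc (Suc 0)))"
  proof (rule power_bound_integrates[OF _ r1 c _ s])
    show "((\<lambda>s. f s - (s ^ 2 / 2) *\<^sub>R f2 0 - (s ^ 3 / 6) *\<^sub>R f3 0) has_vector_derivative
        f1 s - s *\<^sub>R f2 0 - (s ^ 2 / 2) *\<^sub>R f3 0) (at s within {0..h})" if "s \<in> {0..h}" for s
      by (auto intro!: derivative_eq_intros f[OF that] simp: power2_eq_square)
  qed (use zero in auto)
  then show ?thesis by (simp add: eval_nat_numeral)
qed

lemma taylor_quadratic_bound:
  fixes f :: "real \<Rightarrow> 'a::banach"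
  assumes f: "\<And>s. s \<in> {0..h} \<Longrightarrow> (f has_vector_derivative f1 s) (at s within {0..h})"
    and f1: "\<And>s. s \<in> {0..h} \<Longrightarrow> (f1 has_vector_derivative f2 s) (at s within {0..h})"
    and f2: "\<And>s. s \<in> {0..h} \<Longrightarrow> norm (f2 s) \<le> c"
    and zero: "f 0 = 0" "f1 0 = 0" and s: "s \<in> {0..h}"
  shows "norm (f s) \<le> c * s\<^sup>2"
proof -
  have c: "0 \<le> c" using order_trans[OF norm_ge_zero f2[OF s]] .
  have "norm (f1 s) \<le> c * s ^ Suc 0" if "s \<in> {0..h}" for s
    by (rule power_bound_integrates[OF f1 _ c zero(2) that]) (use f2 in auto)
  from power_bound_integrates[OF f this c zero(1) s] show ?thesis by (simp add: power2_eq_square)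
qed

lemma has_vector_derivative_frechet_chain:
  assumes "(G has_derivative G') (at (y s))" "(y has_vector_derivative y') (at s within X)"
  shows "((\<lambda>s. G (y s)) has_vector_derivative G' y') (at s within X)"
  using vector_derivative_diff_chain_within[OF assms(2) has_derivative_at_withinI[OF assms(1)]]
  by (simp add: o_def)

lemma has_vector_derivative_blinfun_apply:
  assumes "(F has_vector_derivative F') (at s within X)" "(x has_vector_derivative x') (at s within X)"
  shows "((\<lambda>s. blinfun_apply (F s) (x s)) has_vector_derivative blinfun_apply (F s) x' + blinfun_apply F' (x s)) (at s within X)"
  by (rule bounded_bilinear.has_vector_derivative[OF bounded_bilinear_blinfun_apply assms])

lemma norm_blinfun_le:
  assumes "norm F \<le> a" "norm x \<le> b"
  shows "norm (blinfun_apply F x) \<le> a * b"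
  using assms by (intro order_trans[OF norm_blinfun] mult_mono) (auto intro: order_trans[OF norm_ge_zero])

text \<open>The second difference \<open>g(x + ta + tb) - g(x + ta) - g(x + tb) + g(x)\<close> is symmetric in \<open>a\<close> and
  \<open>b\<close>, and it equals \<open>t\<^sup>2 g''(x)(b)(a) + o(t\<^sup>2)\<close> by the mean value theorem in direction \<open>a\<close>.\<close>

lemma second_difference_bound:
  fixes g :: "'a::banach \<Rightarrow> 'b::banach" and g1 :: "'a \<Rightarrow> 'a \<Rightarrow>\<^sub>L 'b" and g2 :: "'a \<Rightarrow>\<^sub>L 'a \<Rightarrow>\<^sub>L 'b"
  assumes g: "\<And>y. norm (y - x) < d \<Longrightarrow> (g has_derivative blinfun_apply (g1 y)) (at y)"
    and g1: "\<And>y. norm (y - x) < d \<Longrightarrow> norm (g1 y - g1 x - g2 (y - x)) \<le> e * norm (y - x)"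
    and t: "0 < t" "t * (norm a + norm b) < d" and e: "0 \<le> e"
  shows "norm (g (x + t *\<^sub>R a + t *\<^sub>R b) - g (x + t *\<^sub>R a) - g (x + t *\<^sub>R b) + g x - t\<^sup>2 *\<^sub>R g2 b a)
    \<le> 2 * e * (norm a + norm b)\<^sup>2 * t\<^sup>2"
proof -
  define p where "p s = x + (s * t) *\<^sub>R a" for s
  define \<psi> where "\<psi> s = g (p s + t *\<^sub>R b) - g (p s) - s *\<^sub>R (t\<^sup>2 *\<^sub>R g2 b a)" for s
  define \<psi>' where "\<psi>' s = g1 (p s + t *\<^sub>R b) (t *\<^sub>R a) - g1 (p s) (t *\<^sub>R a) - t\<^sup>2 *\<^sub>R g2 b a" for s
  define q where "q = t * (norm a + norm b)"
  have close: "norm (p s - x) \<le> q" "norm (p s + t *\<^sub>R b - x) \<le> q" if "s \<in> {0..1}" for s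
  proof -
    have "norm ((s * t) *\<^sub>R a) \<le> t * norm a" using that t by (auto intro!: mult_right_mono mult_left_le_one_le)
    moreover have "norm ((s * t) *\<^sub>R a + t *\<^sub>R b) \<le> norm ((s * t) *\<^sub>R a) + t * norm b"
      using norm_triangle_ineq[of "(s * t) *\<^sub>R a" "t *\<^sub>R b"] t by simp
    moreover have "0 \<le> t * norm b" using t by simp
    ultimately have *: "norm ((s * t) *\<^sub>R a) \<le> q" "norm ((s * t) *\<^sub>R a + t *\<^sub>R b) \<le> q"
      unfolding q_def distrib_left by linarith+
    have eqs: "p s - x = (s * t) *\<^sub>R a" "p s + t *\<^sub>R b - x = (s * t) *\<^sub>R a + t *\<^sub>R b"
      by (simp_all add: p_def)
    show "norm (p s - x) \<le> q" "norm (p s + t *\<^sub>R b - x) \<le> q"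
      unfolding eqs by (fact *)+
  qed
  have qd: "q < d" using t by (simp add: q_def)
  have "norm (\<psi> 1 - \<psi> 0) \<le> (2 * e * q * (t * norm a)) * 1"
  proof (rule vector_mean_value_bound)
    fix s :: real assume s: "s \<in> {0..1}"
    have p': "(p has_vector_derivative t *\<^sub>R a) (at s within {0..1})"
      unfolding p_def by (auto intro!: derivative_eq_intros)
    have pb': "((\<lambda>s. p s + t *\<^sub>R b) has_vector_derivative t *\<^sub>R a) (at s within {0..1})"
      using has_vector_derivative_add[OF p' has_vector_derivative_const] by simp
    have "norm (p s - x) < d" "norm (p s + t *\<^sub>R b - x) < d" using close[OF s] qd by linarith+
    note D = has_vector_derivative_frechet_chain[OF g[OF this(1)] p']
      has_vector_derivative_frechet_chain[OF g[OF this(2)] pb']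
    show "(\<psi> has_vector_derivative \<psi>' s) (at s within {0..1})"
      unfolding \<psi>_def \<psi>'_def by (auto intro!: derivative_eq_intros D)
    let ?R = "\<lambda>y. g1 y - g1 x - g2 (y - x)"
    have "\<psi>' s = (?R (p s + t *\<^sub>R b) - ?R (p s)) (t *\<^sub>R a)"
      by (simp add: \<psi>'_def blinfun.bilinear_simps power2_eq_square algebra_simps)
    moreover have "norm (?R (p s + t *\<^sub>R b) - ?R (p s)) \<le> 2 * e * q"
    proof -
      have "norm (?R (p s + t *\<^sub>R b)) \<le> e * q" "norm (?R (p s)) \<le> e * q"
        using g1[of "p s + t *\<^sub>R b"] g1[of "p s"] close[OF s] qd e
        by (meson le_less_trans mult_left_mono order_trans)+
      then show ?thesis using norm_triangle_ineq4[of "?R (p s + t *\<^sub>R b)" "?R (p s)"] by linarith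
    qed
    ultimately show "norm (\<psi>' s) \<le> 2 * e * q * (t * norm a)"
      using t by (auto intro!: norm_blinfun_le)
  qed simp
  also have "\<psi> 1 - \<psi> 0 = g (x + t *\<^sub>R a + t *\<^sub>R b) - g (x + t *\<^sub>R a) - g (x + t *\<^sub>R b) + g x - t\<^sup>2 *\<^sub>R g2 b a"
    by (simp add: \<psi>_def p_def algebra_simps)
  also have "(2 * e * q * (t * norm a)) * 1 \<le> 2 * e * q * q"
    using e t unfolding q_def by (auto intro!: mult_left_mono mult_nonneg_nonneg)
  also have "\<dots> = 2 * e * (norm a + norm b)\<^sup>2 * t\<^sup>2" by (simp add: q_def power2_eq_square)
  finally show ?thesis .
qed

text \<open>Both orders of differentiation approximate the same second difference up to \<open>o(t\<^sup>2)\<close>.\<close>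

lemma second_derivative_symmetric:
  fixes g :: "'a::banach \<Rightarrow> 'b::banach"
  assumes V: "open V" "x \<in> V"
    and g: "\<And>y. y \<in> V \<Longrightarrow> (g has_derivative blinfun_apply (g1 y)) (at y)"
    and g1: "(g1 has_derivative blinfun_apply g2) (at x)"
  shows "blinfun_apply (blinfun_apply g2 a) b = blinfun_apply (blinfun_apply g2 b) a"
proof -
  define Q where "Q = (norm a + norm b)\<^sup>2"
  have bound: "norm (g2 a b - g2 b a) \<le> 4 * e * Q" if e: "0 < e" for e
  proof -
    obtain r where r: "0 < r" "ball x r \<subseteq> V" using V openE by blast
    obtain d where d: "0 < d" "\<And>y. norm (y - x) < d \<Longrightarrow> norm (g1 y - g1 x - g2 (y - x)) \<le> e * norm (y - x)"
      using g1 e unfolding has_derivative_at_alt by blast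
    define d' where "d' = min r d"
    have d'0: "0 < d'" using r d by (simp add: d'_def)
    have gd: "(g has_derivative blinfun_apply (g1 y)) (at y)" if "norm (y - x) < d'" for y
      using that r g[of y] by (auto simp: d'_def dist_norm norm_minus_commute)
    have g1d: "norm (g1 y - g1 x - g2 (y - x)) \<le> e * norm (y - x)" if "norm (y - x) < d'" for y
      using that d by (auto simp: d'_def)
    define t where "t = d' / (2 * (norm a + norm b + 1))"
    have t: "0 < t" using d'0 by (auto simp: t_def intro!: divide_pos_pos add_nonneg_pos)
    have "t * (norm a + norm b) \<le> t * (norm a + norm b + 1)" using t by simp
    also have "\<dots> = d' / 2"
    proof -
      have "norm a + norm b + 1 \<noteq> 0" using norm_ge_zero[of a] norm_ge_zero[of b] by linarith
      then show ?thesis by (simp add: t_def field_simps)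
    qed
    finally have td: "t * (norm a + norm b) < d'" using d'0 by simp
    let ?\<Delta> = "g (x + t *\<^sub>R a + t *\<^sub>R b) - g (x + t *\<^sub>R a) - g (x + t *\<^sub>R b) + g x"
    have "norm (?\<Delta> - t\<^sup>2 *\<^sub>R g2 b a) \<le> 2 * e * Q * t\<^sup>2"
      unfolding Q_def using e by (intro second_difference_bound[OF gd g1d t td]) auto
    moreover have "norm (?\<Delta> - t\<^sup>2 *\<^sub>R g2 a b) \<le> 2 * e * Q * t\<^sup>2"
    proof -
      have "t * (norm b + norm a) < d'" using td by (simp add: add.commute)
      from second_difference_bound[OF gd g1d t this less_imp_le[OF e]] show ?thesis
        by (simp add: Q_def algebra_simps)
    qed
    moreover have "t\<^sup>2 *\<^sub>R (g2 a b - g2 b a) = (?\<Delta> - t\<^sup>2 *\<^sub>R g2 b a) - (?\<Delta> - t\<^sup>2 *\<^sub>R g2 a b)"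
      by (simp add: scaleR_diff_right)
    ultimately have "norm (t\<^sup>2 *\<^sub>R (g2 a b - g2 b a)) \<le> 4 * e * Q * t\<^sup>2"
      using norm_triangle_ineq4[of "?\<Delta> - t\<^sup>2 *\<^sub>R g2 b a" "?\<Delta> - t\<^sup>2 *\<^sub>R g2 a b"] by simp
    then show ?thesis using t by (simp add: mult.commute)
  qed
  have "norm (g2 a b - g2 b a) \<le> 0"
  proof (rule field_le_epsilon)
    fix e :: real assume e: "0 < e"
    have Q: "0 \<le> Q" by (simp add: Q_def)
    have "4 * (e / (4 * (Q + 1))) * Q \<le> e" using Q e by (simp add: field_simps)
    moreover have "0 < e / (4 * (Q + 1))" using Q e by simp
    ultimately show "norm (g2 a b - g2 b a) \<le> 0 + e" using bound by force
  qed
  then show ?thesis by simp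
qed

section \<open>The error of one step in terms of the inhomogeneity\<close>

lemma generates_semigroup_of: "is_generator D A \<Longrightarrow> generates D A (semigroup_of D A)"
  unfolding is_generator_def semigroup_of_def by (rule someI_ex[of "generates D A"])

lemma power_fact_le_one: "0 \<le> \<theta> \<Longrightarrow> \<theta> \<le> 1 \<Longrightarrow> \<theta> ^ k / fact k \<le> (1::real)"
  using order_trans[OF power_le_one[of \<theta> k] fact_ge_1[of k]] by simp

lemma has_integral_power_fact: "((\<lambda>\<theta>::real. \<theta> ^ k / fact k) has_integral 1 / fact (Suc k)) {0..1}"
proof -
  have "(\<lambda>\<theta>::real. \<theta> ^ k / fact k) integrable_on {0..1}"
    by (intro integrable_continuous_real continuous_intros) auto
  moreover have "integral {0..1} (\<lambda>\<theta>::real. \<theta> ^ k / fact k) = 1 / fact (Suc k)"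
    using phi_real_zero[of "Suc k"] by (simp del: fact_Suc)
  ultimately show ?thesis by (metis integrable_integral)
qed

context
  fixes D :: "'a::banach set" and J :: "'a \<Rightarrow> 'a" and h N :: real
  assumes J: "is_generator D J" and h: "0 < h"
    and N: "\<And>t. t \<in> {0..h} \<Longrightarrow> norm (semigroup_of D J t) \<le> N"
begin

abbreviation (input) expJ :: "real \<Rightarrow> 'a \<Rightarrow>\<^sub>L 'a" where "expJ \<equiv> semigroup_of D J"

lemmas genJ = generates_semigroup_of[OF J]
lemmas c0J = generates_c0[OF genJ]

lemma bound_constant_nonneg: "0 \<le> N"
  using N[of 0] h order_trans[OF norm_ge_zero] by simp

lemma phi_op_integrable:
  assumes "\<tau> \<in> {0..h}"
  shows "(\<lambda>\<theta>::real. (\<theta> ^ k / fact k) *\<^sub>R blinfun_apply (expJ ((1 - \<theta>) * \<tau>)) x) integrable_on {0..1}"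
  using assms by (intro integrable_continuous_real continuous_on_scaleR c0_semigroup_continuous_on[OF c0J] continuous_intros) auto

lemma phi_op_add:
  assumes "\<tau> \<in> {0..h}"
  shows "phi_op (Suc k) D J \<tau> (x + y) = phi_op (Suc k) D J \<tau> x + phi_op (Suc k) D J \<tau> y"
  by (simp only: phi_op.simps blinfun.add_right scaleR_add_right integral_add phi_op_integrable[OF assms])

lemma phi_op_scaleR:
  "phi_op (Suc k) D J \<tau> (c *\<^sub>R x) = c *\<^sub>R phi_op (Suc k) D J \<tau> x"
proof -
  have "phi_op (Suc k) D J \<tau> (c *\<^sub>R x) =
      integral {0..1} (\<lambda>\<theta>::real. c *\<^sub>R ((\<theta> ^ k / fact k) *\<^sub>R blinfun_apply (expJ ((1 - \<theta>) * \<tau>)) x))"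
    by (simp add: blinfun.scaleR_right mult.commute)
  then show ?thesis by (simp only: phi_op.simps integral_cmul)
qed

lemma phi_op_bound:
  assumes \<tau>: "\<tau> \<in> {0..h}"
  shows "norm (phi_op (Suc k) D J \<tau> x) \<le> N * norm x"
proof -
  have "norm (phi_op (Suc k) D J \<tau> x) \<le> N * norm x * 1"
    unfolding phi_op.simps
  proof (rule has_integral_norm_bound[OF _ integrable_integral[OF phi_op_integrable[OF \<tau>]]])
    fix \<theta> :: real assume \<theta>: "\<theta> \<in> {0..1}"
    have "(1 - \<theta>) * \<tau> \<in> {0..h}" using \<theta> \<tau> mult_left_le_one_le[of \<tau> "1 - \<theta>"] by auto
    then have "norm (expJ ((1 - \<theta>) * \<tau>) x) \<le> N * norm x" by (intro norm_blinfun_le N) auto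
    moreover have "\<bar>\<theta> ^ k / fact k\<bar> \<le> 1" using power_fact_le_one[of \<theta> k] \<theta> by simp
    ultimately have "\<bar>\<theta> ^ k / fact k\<bar> * norm (expJ ((1 - \<theta>) * \<tau>) x) \<le> 1 * (N * norm x)"
      by (intro mult_mono) auto
    then show "norm ((\<theta> ^ k / fact k) *\<^sub>R expJ ((1 - \<theta>) * \<tau>) x) \<le> N * norm x" by simp
  qed simp
  then show ?thesis by simp
qed

text \<open>At step size zero the operator \<open>\<phi>\<^sub>k\<close> is \<open>1/k!\<close>; on the domain of \<open>J\<close> the difference is of first order.\<close>

lemma phi_op_deviation:
  assumes x: "x \<in> D"
  shows "norm (phi_op (Suc k) D J h x - (1 / fact (Suc k)) *\<^sub>R x) \<le> h * N * norm (J x)"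
proof -
  have hI: "h \<in> {0..h}" using h by simp
  note I = has_integral_scaleR_left[OF has_integral_power_fact[of k], of x]
  note int = has_integral_integrable[OF I]
  have "(1 / fact (Suc k)) *\<^sub>R x = integral {0..1} (\<lambda>\<theta>::real. (\<theta> ^ k / fact k) *\<^sub>R x)"
    by (rule integral_unique[OF I, symmetric])
  then have "phi_op (Suc k) D J h x - (1 / fact (Suc k)) *\<^sub>R x =
      integral {0..1} (\<lambda>\<theta>::real. (\<theta> ^ k / fact k) *\<^sub>R expJ ((1 - \<theta>) * h) x - (\<theta> ^ k / fact k) *\<^sub>R x)"
    by (simp only: phi_op.simps integral_diff phi_op_integrable[OF hI] int)
  also have "norm \<dots> \<le> (h * N * norm (J x)) * 1"
  proof (rule has_integral_norm_bound[OF _ integrable_integral[OF integrable_diff[OF phi_op_integrable[OF hI] int]]])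
    fix \<theta> :: real assume \<theta>: "\<theta> \<in> {0..1}"
    have \<tau>: "(1 - \<theta>) * h \<in> {0..h}" using \<theta> h mult_left_le_one_le[of h "1 - \<theta>"] by auto
    have "norm (expJ ((1 - \<theta>) * h) x - x) \<le> (1 - \<theta>) * h * N * norm (J x)"
      using \<tau> by (intro semigroup_deviation_bound[OF genJ x] N) auto
    also have "\<dots> \<le> h * N * norm (J x)"
      using \<tau> bound_constant_nonneg by (intro mult_right_mono) auto
    finally have dev: "norm (expJ ((1 - \<theta>) * h) x - x) \<le> h * N * norm (J x)" .
    have "\<bar>\<theta> ^ k / fact k\<bar> \<le> 1" using power_fact_le_one[of \<theta> k] \<theta> by simp
    with dev have "\<bar>\<theta> ^ k / fact k\<bar> * norm (expJ ((1 - \<theta>) * h) x - x) \<le> 1 * (h * N * norm (J x))"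
      by (intro mult_mono) auto
    then show "norm ((\<theta> ^ k / fact k) *\<^sub>R expJ ((1 - \<theta>) * h) x - (\<theta> ^ k / fact k) *\<^sub>R x) \<le> h * N * norm (J x)"
      by (simp flip: scaleR_diff_right)
  qed simp
  finally show ?thesis by simp
qed

text \<open>In unscaled form, \<open>\<phi>\<^sub>k(\<tau>J)\<close> is the response at time \<open>\<tau>\<close> to the inhomogeneity \<open>s\<^sup>k\<^sup>-\<^sup>1/(k-1)!\<close>; this is
  how Taylor polynomials of the inhomogeneity turn into combinations of these operators.\<close>

lemma phi_op_convolution:
  assumes \<tau>: "\<tau> \<in> {0..h}"
  shows "((\<lambda>s. blinfun_apply (expJ (\<tau> - s)) ((s ^ k / fact k) *\<^sub>R x)) has_integral
    \<tau> ^ Suc k *\<^sub>R phi_op (Suc k) D J \<tau> x) {0..\<tau>}"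
proof -
  have "integral {0..\<tau>} (\<lambda>s. expJ (\<tau> - s) ((s ^ k / fact k) *\<^sub>R x)) =
      \<tau> *\<^sub>R integral {0..1} (\<lambda>\<theta>. expJ (\<tau> * (1 - \<theta>)) (((\<tau> * \<theta>) ^ k / fact k) *\<^sub>R x))"
    using \<tau> by (intro convolution_scaled) auto
  also have "\<dots> = \<tau> *\<^sub>R integral {0..1} (\<lambda>\<theta>. \<tau> ^ k *\<^sub>R ((\<theta> ^ k / fact k) *\<^sub>R expJ ((1 - \<theta>) * \<tau>) x))"
    by (simp add: blinfun.scaleR_right power_mult_distrib mult.commute)
  also have "\<dots> = \<tau> ^ Suc k *\<^sub>R phi_op (Suc k) D J \<tau> x"
    by (simp only: integral_cmul) simp
  finally have "integral {0..\<tau>} (\<lambda>s. expJ (\<tau> - s) ((s ^ k / fact k) *\<^sub>R x)) = \<tau> ^ Suc k *\<^sub>R phi_op (Suc k) D J \<tau> x" .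
  moreover have "(\<lambda>s. expJ (\<tau> - s) ((s ^ k / fact k) *\<^sub>R x)) integrable_on {0..\<tau>}"
    by (intro convolution_integrable[OF c0J] continuous_intros) auto
  ultimately show ?thesis by (metis integrable_integral)
qed

lemma convolution_bound:
  assumes \<tau>: "\<tau> \<in> {0..h}" and f: "\<And>s. s \<in> {0..\<tau>} \<Longrightarrow> norm (f s) \<le> c"
    and I: "((\<lambda>s. blinfun_apply (expJ (\<tau> - s)) (f s)) has_integral I) {0..\<tau>}"
  shows "norm I \<le> N * c * \<tau>"
proof (rule has_integral_norm_bound[OF _ I])
  show "norm (expJ (\<tau> - s) (f s)) \<le> N * c" if "s \<in> {0..\<tau>}" for s
    using that \<tau> by (intro norm_blinfun_le N f) auto
qed (use \<tau> in auto)

text \<open>The exact solution satisfies \<open>y' = J y + b + f\<close>, where \<open>b\<close> is the value of the nonlinear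
  remainder at \<open>y(0)\<close> and \<open>f\<close> its increment along the solution. An exponential Euler step solves the
  equation with \<open>f\<close> omitted.\<close>

context
  fixes y f :: "real \<Rightarrow> 'a" and b :: 'a
  assumes yD: "\<And>s. s \<in> {0..h} \<Longrightarrow> y s \<in> D"
    and y': "\<And>s. s \<in> {0..h} \<Longrightarrow> (y has_vector_derivative J (y s) + b + f s) (at s within {0..h})"
begin

text \<open>Variation of constants for \<open>y - y(0)\<close>, which starts at \<open>0\<close> and has the inhomogeneity \<open>J (y(0)) + b + f\<close>.\<close>

lemma exponential_euler_defect:
  assumes \<tau>: "\<tau> \<in> {0..h}"
  shows "((\<lambda>s. blinfun_apply (expJ (\<tau> - s)) (f s)) has_integral
    (y \<tau> - (y 0 + \<tau> *\<^sub>R phi_op 1 D J \<tau> (J (y 0) + b)))) {0..\<tau>}"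
proof -
  define z where "z s = y s - y 0" for s
  let ?F = "J (y 0) + b"
  have zI: "z s \<in> D \<and> J (z s) = J (y s) - J (y 0)" if "s \<in> {0..h}" for s
    unfolding z_def using that h by (intro generator_diff[OF genJ] yD) auto
  have z': "(z has_vector_derivative J (z s) + (?F + f s)) (at s within {0..\<tau>})" if s: "s \<in> {0..\<tau>}" for s
  proof -
    have "(y has_vector_derivative J (y s) + b + f s) (at s within {0..\<tau>})"
      using s \<tau> by (intro has_vector_derivative_within_subset[OF y']) auto
    from has_vector_derivative_diff[OF this has_vector_derivative_const[of "y 0"]]
    show ?thesis using zI[of s] s \<tau> unfolding z_def[abs_def] by (simp add: algebra_simps)
  qed
  have "((\<lambda>s. expJ (\<tau> - s) (?F + f s)) has_integral (z \<tau> - expJ \<tau> (z 0))) {0..\<tau>}"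
    using \<tau> zI z' by (intro variation_of_constants[OF genJ]) auto
  moreover have "((\<lambda>s. expJ (\<tau> - s) ((s ^ 0 / fact 0) *\<^sub>R ?F)) has_integral \<tau> ^ Suc 0 *\<^sub>R phi_op (Suc 0) D J \<tau> ?F) {0..\<tau>}"
    by (rule phi_op_convolution[OF \<tau>])
  ultimately have "((\<lambda>s. expJ (\<tau> - s) (?F + f s) - expJ (\<tau> - s) ((s ^ 0 / fact 0) *\<^sub>R ?F)) has_integral
      (z \<tau> - expJ \<tau> (z 0)) - \<tau> ^ Suc 0 *\<^sub>R phi_op (Suc 0) D J \<tau> ?F) {0..\<tau>}"
    by (rule has_integral_diff)
  then show ?thesis by (simp add: z_def blinfun.add_right diff_diff_eq)
qed

lemma stage_error:
  assumes \<tau>: "\<tau> \<in> {0..h}" and Q: "0 \<le> Q" and f: "\<And>s. s \<in> {0..h} \<Longrightarrow> norm (f s) \<le> Q * s\<^sup>2"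
  shows "norm (y 0 + \<tau> *\<^sub>R phi_op 1 D J \<tau> (J (y 0) + b) - y \<tau>) \<le> N * Q * \<tau> ^ 3"
proof -
  have "norm (f s) \<le> Q * \<tau>\<^sup>2" if s: "s \<in> {0..\<tau>}" for s
  proof -
    have "norm (f s) \<le> Q * s\<^sup>2" using f s \<tau> by auto
    also have "\<dots> \<le> Q * \<tau>\<^sup>2" using s Q by (intro mult_left_mono power_mono) auto
    finally show ?thesis .
  qed
  from convolution_bound[OF \<tau> this exponential_euler_defect[OF \<tau>]]
  show ?thesis by (simp add: norm_minus_commute power3_eq_cube power2_eq_square mult_ac)
qed

text \<open>Taylor expansion of \<open>f\<close> turns the defect into \<open>h\<^sup>3 \<phi>\<^sub>3 a + h\<^sup>4 \<phi>\<^sub>4 w + O(h\<^sup>5)\<close>. With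
  \<open>b\<^sub>2 = (32/9)\<phi>\<^sub>3\<close> and \<open>c\<^sub>2 = 3/4\<close> the correction term is \<open>h\<^sup>3 \<phi>\<^sub>3 a + h\<^sup>4 (\<phi>\<^sub>3/4) w + O(h\<^sup>5)\<close>. The terms
  with \<open>a\<close> cancel for every \<open>h\<close>, while \<open>\<phi>\<^sub>3/4\<close> and \<open>\<phi>\<^sub>4\<close> only agree at \<open>h = 0\<close>; this is where
  \<open>w\<close> has to lie in the domain of \<open>J\<close>.\<close>

lemma rosenbrock_step_error:
  assumes Q: "0 \<le> Q" and taylor: "\<And>s. s \<in> {0..h} \<Longrightarrow> norm (f s - (s\<^sup>2 / 2) *\<^sub>R a - (s ^ 3 / 6) *\<^sub>R w) \<le> Q * s ^ 4"
    and w: "w \<in> D" "norm (J w) \<le> W"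
    and \<delta>: "norm (\<delta> - f (3 / 4 * h)) \<le> P * h ^ 4"
  shows "norm (y 0 + h *\<^sub>R phi_op 1 D J h (J (y 0) + b) + h *\<^sub>R ((32 / 9) *\<^sub>R phi_op 3 D J h \<delta>) - y h)
    \<le> (N * Q + 5 / 4 * N * W + 32 / 9 * N * (P + Q)) * h ^ 5"
proof -
  have hI: "h \<in> {0..h}" using h by simp
  let ?c = "3 / 4 * h"
  have cI: "?c \<in> {0..h}" using h by simp
  define r where "r s = f s - (s\<^sup>2 / 2) *\<^sub>R a - (s ^ 3 / 6) *\<^sub>R w" for s
  define \<rho> where "\<rho> = (\<delta> - f ?c) + r ?c"
  have three: "Suc 2 = 3" and four: "Suc 3 = 4" and facts: "fact 2 = (2::real)" "fact 3 = (6::real)"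
    by (simp_all add: fact_numeral)
  define I where "I = y h - (y 0 + h *\<^sub>R phi_op 1 D J h (J (y 0) + b))
      - h ^ 3 *\<^sub>R phi_op 3 D J h a - h ^ 4 *\<^sub>R phi_op 4 D J h w"
  have "((\<lambda>s. expJ (h - s) (r s)) has_integral I) {0..h}"
  proof -
    have A: "((\<lambda>s. expJ (h - s) ((s\<^sup>2 / 2) *\<^sub>R a)) has_integral h ^ 3 *\<^sub>R phi_op 3 D J h a) {0..h}"
      using phi_op_convolution[OF hI, of 2 a] by (simp only: three facts)
    have B: "((\<lambda>s. expJ (h - s) ((s ^ 3 / 6) *\<^sub>R w)) has_integral h ^ 4 *\<^sub>R phi_op 4 D J h w) {0..h}"
      using phi_op_convolution[OF hI, of 3 w] by (simp only: four facts)
    show ?thesis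
      using has_integral_diff[OF has_integral_diff[OF exponential_euler_defect[OF hI] A] B]
      unfolding r_def I_def by (simp only: blinfun.diff_right)
  qed
  moreover have "norm (r s) \<le> Q * h ^ 4" if s: "s \<in> {0..h}" for s
  proof -
    have "norm (r s) \<le> Q * s ^ 4" unfolding r_def by (rule taylor[OF s])
    also have "\<dots> \<le> Q * h ^ 4" using s Q by (intro mult_left_mono power_mono) auto
    finally show ?thesis .
  qed
  note r_le = this
  ultimately have I: "norm I \<le> N * (Q * h ^ 4) * h"
    by (intro convolution_bound[OF hI r_le])
  have \<rho>: "norm \<rho> \<le> (P + Q) * h ^ 4"
    unfolding \<rho>_def using norm_triangle_ineq[of "\<delta> - f ?c" "r ?c"] \<delta> r_le[OF cI]
    by (simp add: distrib_right)
  \<comment> \<open>With \<open>c = 3/4\<close>: \<open>c\<^sup>2/2 = 9/32\<close> and \<open>c\<^sup>3/6 = 9/128\<close>; times \<open>32/9\<close> these are \<open>1\<close> and \<open>1/4\<close>.\<close>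
  have \<delta>_eq: "\<delta> = (9 / 32 * h\<^sup>2) *\<^sub>R a + ((9 / 128 * h ^ 3) *\<^sub>R w + \<rho>)"
    by (simp add: \<rho>_def r_def power_mult_distrib power2_eq_square power3_eq_cube)
  have "phi_op 3 D J h \<delta> = (9 / 32 * h\<^sup>2) *\<^sub>R phi_op 3 D J h a
      + ((9 / 128 * h ^ 3) *\<^sub>R phi_op 3 D J h w + phi_op 3 D J h \<rho>)"
    using phi_op_add[OF hI, of 2] phi_op_scaleR[of 2] unfolding three by (subst \<delta>_eq) simp
  then have corr: "h *\<^sub>R ((32 / 9) *\<^sub>R phi_op 3 D J h \<delta>) = h ^ 3 *\<^sub>R phi_op 3 D J h a
      + (h ^ 4 / 4) *\<^sub>R phi_op 3 D J h w + (32 / 9 * h) *\<^sub>R phi_op 3 D J h \<rho>"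
    by (simp add: scaleR_add_right eval_nat_numeral mult_ac)
  \<comment> \<open>\<open>(1/4)(1/6) = 1/24\<close>, so the leading parts of \<open>\<phi>\<^sub>3/4\<close> and \<open>\<phi>\<^sub>4\<close> drop out of the difference.\<close>
  define d3 where "d3 = phi_op 3 D J h w - (1 / 6) *\<^sub>R w"
  define d4 where "d4 = phi_op 4 D J h w - (1 / 24) *\<^sub>R w"
  have "norm d3 \<le> h * N * norm (J w)" "norm d4 \<le> h * N * norm (J w)"
    using phi_op_deviation[OF w(1), of 2] phi_op_deviation[OF w(1), of 3]
    unfolding d3_def d4_def three four by (simp_all add: fact_numeral)
  moreover have "h * N * norm (J w) \<le> h * N * W"
    using w(2) h bound_constant_nonneg by (intro mult_left_mono) auto
  ultimately have d: "norm d3 \<le> h * N * W" "norm d4 \<le> h * N * W" by linarith+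
  have split: "y 0 + h *\<^sub>R phi_op 1 D J h (J (y 0) + b) + h *\<^sub>R ((32 / 9) *\<^sub>R phi_op 3 D J h \<delta>) - y h
      = (32 / 9 * h) *\<^sub>R phi_op 3 D J h \<rho> + ((h ^ 4 / 4) *\<^sub>R d3 - h ^ 4 *\<^sub>R d4) - I"
    unfolding corr I_def d3_def d4_def by (simp add: algebra_simps)
  have n1: "norm ((32 / 9 * h) *\<^sub>R phi_op 3 D J h \<rho>) \<le> 32 / 9 * h * (N * ((P + Q) * h ^ 4))"
  proof -
    have "norm (phi_op 3 D J h \<rho>) \<le> N * norm \<rho>" using phi_op_bound[OF hI, of 2 \<rho>] unfolding three .
    also have "\<dots> \<le> N * ((P + Q) * h ^ 4)" by (intro mult_left_mono \<rho> bound_constant_nonneg)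
    finally show ?thesis using h by simp
  qed
  have n3: "norm ((h ^ 4 / 4) *\<^sub>R d3) \<le> h ^ 4 / 4 * (h * N * W)"
    using mult_left_mono[OF d(1), of "h ^ 4 / 4"] h by simp
  have n4: "norm (h ^ 4 *\<^sub>R d4) \<le> h ^ 4 * (h * N * W)"
    using mult_left_mono[OF d(2), of "h ^ 4"] h by simp
  have "norm ((32 / 9 * h) *\<^sub>R phi_op 3 D J h \<rho> + ((h ^ 4 / 4) *\<^sub>R d3 - h ^ 4 *\<^sub>R d4) - I)
      \<le> 32 / 9 * h * (N * ((P + Q) * h ^ 4)) + (h ^ 4 / 4 * (h * N * W) + h ^ 4 * (h * N * W)) + N * (Q * h ^ 4) * h"
    by (intro order_trans[OF norm_triangle_ineq4] add_mono order_trans[OF norm_triangle_ineq] n1 n3 n4 I)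
  also have "\<dots> = (N * Q + 5 / 4 * N * W + 32 / 9 * N * (P + Q)) * h ^ 5"
    by (simp add: eval_nat_numeral field_simps)
  finally show ?thesis unfolding split .
qed

end

end

section \<open>The nonlinear remainder along the solution\<close>

text \<open>Bounds for the second and fourth derivative of the increment defined below, shaped like the
  derivatives themselves.\<close>

definition incr2_const :: "real \<Rightarrow> real \<Rightarrow> real" where
  "incr2_const K L = (K + K) * L + K * L * L"

definition incr4_const :: "real \<Rightarrow> real \<Rightarrow> real" where
  "incr4_const K L = (((K + K) * L + K * L * L) + (K * L * L + (K * L + K * L * L) * L))
    + ((K * L * L + (K * L + K * L * L) * L)
      + ((K * L + K * L * L) * L
        + ((K * L + K * L * L) + (K * L * L + (K * L + K * L * L) * L)) * L))"

text \<open>The increment of the nonlinear remainder along the solution has a double zero, since the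
  derivative of \<open>x \<mapsto> g x - g'(v) x\<close> vanishes at \<open>v\<close>. Its third derivative there is
  the expression of the compatibility condition, up to the symmetry of \<open>g''(v)\<close>.\<close>

context
  fixes g :: "'a::banach \<Rightarrow> 'a" and g1 :: "'a \<Rightarrow> 'a \<Rightarrow>\<^sub>L 'a" and g2 g3 g4
    and V :: "'a set" and K L h :: real and y y1 y2 y3 y4 :: "real \<Rightarrow> 'a"
  assumes g: "smooth_nonlinearity V K g g1 g2 g3 g4" and V: "open V"
    and yV: "\<And>s. s \<in> {0..h} \<Longrightarrow> y s \<in> V" and h: "0 \<le> h"
    and y: "\<And>s. s \<in> {0..h} \<Longrightarrow> (y has_vector_derivative y1 s) (at s within {0..h})"
    and y1: "\<And>s. s \<in> {0..h} \<Longrightarrow> (y1 has_vector_derivative y2 s) (at s within {0..h})"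
    and y2: "\<And>s. s \<in> {0..h} \<Longrightarrow> (y2 has_vector_derivative y3 s) (at s within {0..h})"
    and y3: "\<And>s. s \<in> {0..h} \<Longrightarrow> (y3 has_vector_derivative y4 s) (at s within {0..h})"
    and y1_le: "\<And>s. s \<in> {0..h} \<Longrightarrow> norm (y1 s) \<le> L"
    and y2_le: "\<And>s. s \<in> {0..h} \<Longrightarrow> norm (y2 s) \<le> L"
    and y3_le: "\<And>s. s \<in> {0..h} \<Longrightarrow> norm (y3 s) \<le> L"
    and y4_le: "\<And>s. s \<in> {0..h} \<Longrightarrow> norm (y4 s) \<le> L"
begin

lemma
  assumes "x \<in> V"
  shows g_deriv: "(g has_derivative blinfun_apply (g1 x)) (at x)"
    and g1_deriv: "(g1 has_derivative blinfun_apply (g2 x)) (at x)"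
    and g2_deriv: "(g2 has_derivative blinfun_apply (g3 x)) (at x)"
    and g3_deriv: "(g3 has_derivative blinfun_apply (g4 x)) (at x)"
    and g1_le: "norm (g1 x) \<le> K" and g2_le: "norm (g2 x) \<le> K"
    and g3_le: "norm (g3 x) \<le> K" and g4_le: "norm (g4 x) \<le> K"
  using g assms by (auto simp: smooth_nonlinearity_def)

definition incr :: "real \<Rightarrow> 'a" where
  "incr s = nonlin_rem g g1 (y 0) (y s) - nonlin_rem g g1 (y 0) (y 0)"

text \<open>The derivatives are written exactly as the product rule produces them, without collecting terms.\<close>

definition incr1 :: "real \<Rightarrow> 'a" where
  "incr1 s = (g1 (y s) - g1 (y 0)) (y1 s)"

definition incr2 :: "real \<Rightarrow> 'a" where
  "incr2 s = (g1 (y s) - g1 (y 0)) (y2 s) + g2 (y s) (y1 s) (y1 s)"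

definition incr3 :: "real \<Rightarrow> 'a" where
  "incr3 s = ((g1 (y s) - g1 (y 0)) (y3 s) + g2 (y s) (y1 s) (y2 s))
    + (g2 (y s) (y1 s) (y2 s) + (g2 (y s) (y2 s) + g3 (y s) (y1 s) (y1 s)) (y1 s))"

definition incr4 :: "real \<Rightarrow> 'a" where
  "incr4 s = (((g1 (y s) - g1 (y 0)) (y4 s) + g2 (y s) (y1 s) (y3 s))
      + (g2 (y s) (y1 s) (y3 s) + (g2 (y s) (y2 s) + g3 (y s) (y1 s) (y1 s)) (y2 s)))
    + ((g2 (y s) (y1 s) (y3 s) + (g2 (y s) (y2 s) + g3 (y s) (y1 s) (y1 s)) (y2 s))
      + ((g2 (y s) (y2 s) + g3 (y s) (y1 s) (y1 s)) (y2 s)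
        + ((g2 (y s) (y3 s) + g3 (y s) (y1 s) (y2 s))
          + (g3 (y s) (y1 s) (y2 s) + (g3 (y s) (y2 s) + g4 (y s) (y1 s) (y1 s)) (y1 s))) (y1 s)))"

context
  fixes s assumes s: "s \<in> {0..h}"
begin

lemma g1_along: "((\<lambda>s. g1 (y s) - g1 (y 0)) has_vector_derivative g2 (y s) (y1 s)) (at s within {0..h})"
  using has_vector_derivative_diff[OF has_vector_derivative_frechet_chain[OF g1_deriv[OF yV[OF s]] y[OF s]]
      has_vector_derivative_const] by simp

lemma g2_along: "((\<lambda>s. g2 (y s)) has_vector_derivative g3 (y s) (y1 s)) (at s within {0..h})"
  by (rule has_vector_derivative_frechet_chain[OF g2_deriv[OF yV[OF s]] y[OF s]])

lemma g3_along: "((\<lambda>s. g3 (y s)) has_vector_derivative g4 (y s) (y1 s)) (at s within {0..h})"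
  by (rule has_vector_derivative_frechet_chain[OF g3_deriv[OF yV[OF s]] y[OF s]])

lemma g2_y1_along: "((\<lambda>s. g2 (y s) (y1 s)) has_vector_derivative
    g2 (y s) (y2 s) + g3 (y s) (y1 s) (y1 s)) (at s within {0..h})"
  by (rule has_vector_derivative_blinfun_apply[OF g2_along y1[OF s]])

lemma incr_derivative: "(incr has_vector_derivative incr1 s) (at s within {0..h})"
proof -
  have "((\<lambda>s. g (y s)) has_vector_derivative g1 (y s) (y1 s)) (at s within {0..h})"
    by (rule has_vector_derivative_frechet_chain[OF g_deriv[OF yV[OF s]] y[OF s]])
  moreover have "((\<lambda>s. g1 (y 0) (y s)) has_vector_derivative g1 (y 0) (y1 s)) (at s within {0..h})"
    using has_vector_derivative_blinfun_apply[OF has_vector_derivative_const y[OF s]] by simp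
  ultimately have "((\<lambda>s. (g (y s) - g1 (y 0) (y s)) - nonlin_rem g g1 (y 0) (y 0)) has_vector_derivative
      (g1 (y s) (y1 s) - g1 (y 0) (y1 s)) - 0) (at s within {0..h})"
    by (intro has_vector_derivative_diff has_vector_derivative_const)
  then show ?thesis
    unfolding incr_def[abs_def] incr1_def by (simp add: nonlin_rem_def blinfun.diff_left)
qed

lemma incr1_derivative: "(incr1 has_vector_derivative incr2 s) (at s within {0..h})"
  unfolding incr1_def[abs_def] incr2_def
  by (rule has_vector_derivative_blinfun_apply[OF g1_along y1[OF s]])

lemma incr2_derivative: "(incr2 has_vector_derivative incr3 s) (at s within {0..h})"
  unfolding incr2_def[abs_def] incr3_def
  by (intro has_vector_derivative_add has_vector_derivative_blinfun_apply g1_along g2_along g2_y1_along y1[OF s] y2[OF s])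

lemma incr3_derivative: "(incr3 has_vector_derivative incr4 s) (at s within {0..h})"
  unfolding incr3_def[abs_def] incr4_def
  by (intro has_vector_derivative_add has_vector_derivative_blinfun_apply g1_along g2_along g3_along g2_y1_along
      y1[OF s] y2[OF s] y3[OF s])

lemma g1_diff_le: "norm (g1 (y s) - g1 (y 0)) \<le> K + K"
  using norm_triangle_ineq4[of "g1 (y s)" "g1 (y 0)"] g1_le[OF yV[OF s]] g1_le[OF yV[of 0]] h by simp

lemmas incr_bounds = norm_triangle_mono norm_blinfun_le g1_diff_le
  g2_le[OF yV[OF s]] g3_le[OF yV[OF s]] g4_le[OF yV[OF s]] y1_le[OF s] y2_le[OF s] y3_le[OF s] y4_le[OF s]

lemma incr2_le: "norm (incr2 s) \<le> incr2_const K L"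
  unfolding incr2_def incr2_const_def by (intro incr_bounds)

lemma incr4_le: "norm (incr4 s) \<le> incr4_const K L"
  unfolding incr4_def incr4_const_def by (intro incr_bounds)

end

lemma incr_zero: "incr 0 = 0" and incr1_zero: "incr1 0 = 0"
  by (simp_all add: incr_def incr1_def)

lemma incr3_zero: "incr3 0 = g3 (y 0) (y1 0) (y1 0) (y1 0) + 3 *\<^sub>R g2 (y 0) (y1 0) (y2 0)"
proof -
  have V0: "y 0 \<in> V" using yV[of 0] h by simp
  have "g2 (y 0) (y2 0) (y1 0) = g2 (y 0) (y1 0) (y2 0)"
    by (rule second_derivative_symmetric[OF V V0 g_deriv g1_deriv[OF V0]])
  moreover have "3 *\<^sub>R x = x + x + x" for x :: 'a
  proof -
    have "(1 + 1 + 1) *\<^sub>R x = x + x + x" by (simp only: scaleR_add_left scaleR_one)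
    then show ?thesis by simp
  qed
  ultimately show ?thesis by (simp add: incr3_def blinfun.add_left)
qed

lemma incr_taylor:
  assumes "s \<in> {0..h}"
  shows "norm (incr s - (s\<^sup>2 / 2) *\<^sub>R g2 (y 0) (y1 0) (y1 0)
    - (s ^ 3 / 6) *\<^sub>R (g3 (y 0) (y1 0) (y1 0) (y1 0) + 3 *\<^sub>R g2 (y 0) (y1 0) (y2 0))) \<le> incr4_const K L * s ^ 4"
  using taylor_quartic_remainder[OF incr_derivative incr1_derivative incr2_derivative incr3_derivative
      incr4_le incr_zero incr1_zero assms]
  by (simp add: incr3_zero incr2_def)

lemma incr_quadratic:
  assumes "s \<in> {0..h}"
  shows "norm (incr s) \<le> incr2_const K L * s\<^sup>2"
  by (rule taylor_quadratic_bound[OF incr_derivative incr1_derivative incr2_le incr_zero incr1_zero assms])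

text \<open>The nonlinear remainder is nearly constant close to the point of linearisation, so an error of
  third order in its argument becomes one of fourth order in its value.\<close>

lemma nonlin_rem_lipschitz:
  assumes ball: "cball v \<rho> \<subseteq> V" and x: "x \<in> cball v \<rho>" "z \<in> cball v \<rho>"
  shows "norm (nonlin_rem g g1 v x - nonlin_rem g g1 v z) \<le> K * \<rho> * norm (x - z)"
proof (rule differentiable_bound[of "cball v \<rho>" _ "\<lambda>p. blinfun_apply (g1 p - g1 v)"])
  fix p assume p: "p \<in> cball v \<rho>"
  have v: "v \<in> cball v \<rho>" using p order_trans[OF zero_le_dist] by auto
  have "(g has_derivative blinfun_apply (g1 p)) (at p)" using p ball by (intro g_deriv) auto
  then have D: "((\<lambda>x. g x - blinfun_apply (g1 v) x) has_derivative (\<lambda>x. g1 p x - g1 v x)) (at p)"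
    by (intro has_derivative_diff bounded_linear.has_derivative[OF blinfun.bounded_linear_right] has_derivative_ident)
  have "blinfun_apply (g1 p - g1 v) = (\<lambda>x. g1 p x - g1 v x)"
    by (rule ext) (rule blinfun.diff_left)
  with has_derivative_at_withinI[OF D]
  show "(nonlin_rem g g1 v has_derivative blinfun_apply (g1 p - g1 v)) (at p within cball v \<rho>)"
    unfolding nonlin_rem_def[abs_def] by (simp only:)
  have "norm (g1 p - g1 v) \<le> K * norm (p - v)"
  proof (rule differentiable_bound[of "cball v \<rho>" _ "\<lambda>q. blinfun_apply (g2 q)"])
    fix q assume "q \<in> cball v \<rho>"
    then have "q \<in> V" using ball by blast
    then show "(g1 has_derivative blinfun_apply (g2 q)) (at q within cball v \<rho>)" "onorm (blinfun_apply (g2 q)) \<le> K"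
      using g2_le[of q] has_derivative_at_withinI[OF g1_deriv[of q]] by (simp_all add: norm_blinfun.rep_eq)
  qed (use p v in auto)
  also have "\<dots> \<le> K * \<rho>"
  proof (rule mult_left_mono)
    show "norm (p - v) \<le> \<rho>" using p by (simp add: dist_norm norm_minus_commute)
    have "v \<in> V" using v ball by blast
    then show "0 \<le> K" using order_trans[OF norm_ge_zero g1_le[of v]] by simp
  qed
  finally show "onorm (blinfun_apply (g1 p - g1 v)) \<le> K * \<rho>" by (simp add: norm_blinfun.rep_eq)
qed (use x in auto)

end

section \<open>The local error\<close>

lemma has_vector_derivative_shift:
  assumes "(f has_vector_derivative f') (at (t + s) within {0..T})" "0 \<le> t" "t + h \<le> T"
  shows "((\<lambda>s. f (t + s)) has_vector_derivative f') (at s within {0..h})"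
proof -
  have "((f \<circ> (\<lambda>s. t + s)) has_vector_derivative 1 *\<^sub>R f') (at s within {0..h})"
  proof (rule vector_diff_chain_within)
    show "((\<lambda>s. t + s) has_vector_derivative 1) (at s within {0..h})"
      by (auto intro!: derivative_eq_intros)
    show "(f has_vector_derivative f') (at (t + s) within (\<lambda>s. t + s) ` {0..h})"
      using assms(2,3) by (intro has_vector_derivative_within_subset[OF assms(1)]) auto
  qed
  then show ?thesis by (simp add: o_def)
qed

text \<open>One step with explicit constants. The upper bounds on \<open>h\<close> serve the estimate of the
  semigroup of the Jacobian and keep the internal stage inside the strip.\<close>

lemma local_error_bound:
  fixes A g :: "'a::banach \<Rightarrow> 'a"
  assumes gen: "is_generator D A" and M: "(SUP t\<in>{0..T}. norm (semigroup_of D A t)) \<le> M"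
    and sol: "classical_solution D A g T t0 u0 u" and u: "smooth_curve T L u u1 u2 u3 u4"
    and g: "smooth_nonlinearity (strip T R u) K g g1 g2 g3 g4"
    and comp: "compatibility_bound D A g2 g3 t0 T B u u1 u2"
    and R: "0 < R" and h: "0 < h" "h \<le> 1" "t0 + real (Suc n) * h \<le> T"
    and small1: "\<bar>M\<bar> * \<bar>K\<bar> * h \<le> 1 / 2"
    and small2: "\<bar>L + 2 * M * incr2_const K L\<bar> * h < R"
    and c2: "c2 = 3 / 4" and comb: "\<And>J x. phi_comb_op m \<beta> D J h x = (32 / 9) *\<^sub>R phi_op 3 D J h x"
  shows "norm (local_error c2 m \<beta> D A g g1 u t0 h n) \<le>
    (2 * M * incr4_const K L + 5 / 4 * (2 * M) * (B + K * (K * L * L * L + 3 * (K * L * L)))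
      + 32 / 9 * (2 * M) * (K * (L + 2 * M * incr2_const K L) * (2 * M * incr2_const K L) + incr4_const K L)) * h ^ 5"
proof -
  define t where "t = t0 + real n * h"
  have t: "0 \<le> t" "t0 \<le> t" "t + h \<le> T" using sol h by (auto simp: t_def classical_solution_def algebra_simps)
  have tI: "t + s \<in> {0..T}" if "s \<in> {0..h}" for s using that t by auto
  define v where "v = u t"
  define y where "y s = u (t + s)" for s
  define y1 where "y1 s = u1 (t + s)" for s
  define y2 where "y2 s = u2 (t + s)" for s
  define y3 where "y3 s = u3 (t + s)" for s
  define y4 where "y4 s = u4 (t + s)" for s
  note y_defs = y_def y1_def y2_def y3_def y4_def
  have y0: "y 0 = v" by (simp add: y_def v_def)
  let ?V = "strip T R u"
  have openV: "open ?V" unfolding strip_def by auto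
  have ballV: "ball v R \<subseteq> ?V" unfolding strip_def v_def using tI[of 0] h by auto
  have yV: "y s \<in> ?V" if "s \<in> {0..h}" for s
    unfolding strip_def y_def using tI[OF that] R by (auto intro!: bexI[of _ "t + s"])
  have derivs: "(y has_vector_derivative y1 s) (at s within {0..h})"
    "(y1 has_vector_derivative y2 s) (at s within {0..h})"
    "(y2 has_vector_derivative y3 s) (at s within {0..h})"
    "(y3 has_vector_derivative y4 s) (at s within {0..h})"
    and y_le: "norm (y1 s) \<le> L" "norm (y2 s) \<le> L" "norm (y3 s) \<le> L" "norm (y4 s) \<le> L"
    if "s \<in> {0..h}" for s
    using u tI[OF that] t unfolding smooth_curve_def y_defs
    by (auto intro!: has_vector_derivative_shift[where T = T])
  note along = g openV yV less_imp_le[OF h(1)] derivs y_le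
  have hI: "0 \<in> {0..h}" "h \<in> {0..h}" "3 / 4 * h \<in> {0..h}" using h by auto
  have L0: "0 \<le> L" using order_trans[OF norm_ge_zero y_le(1)[OF hI(1)]] .
  have vV: "v \<in> ?V" using yV[OF hI(1)] by (simp add: y0)
  have g_le: "norm (g1 v) \<le> K" "norm (g2 v) \<le> K" "norm (g3 v) \<le> K"
    using g vV by (auto simp: smooth_nonlinearity_def)
  have K0: "0 \<le> K" using order_trans[OF norm_ge_zero g_le(1)] .
  have S_le: "norm (semigroup_of D A s) \<le> M" if "s \<in> {0..T}" for s
    using cSUP_upper[OF that c0_semigroup_bdd_above[OF generates_c0[OF generates_semigroup_of[OF gen]]]] M
    by (rule order_trans)
  have M0: "0 \<le> M" using order_trans[OF norm_ge_zero S_le[OF tI[OF hI(1)]]] .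
  let ?N = "2 * M"
  define q where "q = incr2_const K L"
  have q0: "0 \<le> q" using K0 L0 by (simp add: q_def incr2_const_def)
  have p0: "0 \<le> incr4_const K L" using K0 L0 by (simp add: incr4_const_def)

  define J where "J = jacobian A g1 v"
  have J_eq: "J = (\<lambda>x. A x + blinfun_apply (g1 v) x)" by (auto simp: J_def jacobian_def)
  have J: "is_generator D J" unfolding J_eq by (rule bounded_perturbation[OF gen])
  have E_le: "norm (semigroup_of D J s) \<le> ?N" if "s \<in> {0..h}" for s
  proof (rule perturbed_semigroup_bound[OF generates_semigroup_of[OF gen] _ less_imp_le[OF h(1)] _ _ that])
    show "generates D (\<lambda>x. A x + blinfun_apply (g1 v) x) (semigroup_of D J)"
      using generates_semigroup_of[OF J] by (simp add: J_eq)
    show "norm (semigroup_of D A s) \<le> M" if "s \<in> {0..h}" for s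
      using that t by (intro S_le) auto
    have "M * norm (g1 v) * h \<le> \<bar>M\<bar> * \<bar>K\<bar> * h"
      using g_le M0 K0 h by (intro mult_right_mono mult_mono) auto
    then show "M * norm (g1 v) * h \<le> 1 / 2" using small1 by linarith
  qed
  define b where "b = nonlin_rem g g1 v v"
  define f where "f = incr g g1 y"
  have f_eq: "f s = nonlin_rem g g1 v (y s) - b" for s
    unfolding f_def b_def using incr_def[OF along] by (simp add: y0)
  have yD: "y s \<in> D" if "s \<in> {0..h}" for s
    using sol tI[OF that] by (simp add: y_def classical_solution_def)
  have y': "(y has_vector_derivative J (y s) + b + f s) (at s within {0..h})" if s: "s \<in> {0..h}" for s
  proof -
    have "(y has_vector_derivative rhs A g (y s)) (at s within {0..h})"
      unfolding y_def using sol tI[OF s] t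
      by (intro has_vector_derivative_shift[where T = T]) (auto simp: classical_solution_def)
    moreover have "rhs A g (y s) = J (y s) + b + f s"
      by (simp add: f_eq J_eq rhs_def nonlin_rem_def)
    ultimately show ?thesis by simp
  qed
  have F_eq: "rhs A g v = J (y 0) + b"
    by (simp add: b_def J_eq rhs_def nonlin_rem_def y0)

  define U where "U = rosenbrock_stage c2 D A g g1 h v"
  have U_eq: "U = y 0 + (3 / 4 * h) *\<^sub>R phi_op 1 D J (3 / 4 * h) (J (y 0) + b)"
    by (simp only: U_def rosenbrock_stage_def c2 F_eq y0 flip: J_def)
  have f_quad: "norm (f s) \<le> q * s\<^sup>2" if "s \<in> {0..h}" for s
    unfolding f_def q_def using incr_quadratic[OF along that] .
  have U_err: "norm (U - y (3 / 4 * h)) \<le> ?N * q * h ^ 3"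
  proof -
    have "norm (U - y (3 / 4 * h)) \<le> ?N * q * (3 / 4 * h) ^ 3"
      unfolding U_eq by (rule stage_error[OF J h(1) E_le yD y' hI(3) q0 f_quad])
    also have "\<dots> \<le> ?N * q * h ^ 3"
      using M0 q0 h by (intro mult_left_mono power_mono) auto
    finally show ?thesis .
  qed
  \<comment> \<open>Both \<open>U\<close> and the exact value lie within \<open>\<rho> = O(h)\<close> of \<open>v\<close>, and this ball lies in the strip.\<close>
  define \<rho> where "\<rho> = (L + ?N * q) * h"
  have y_near: "norm (y (3 / 4 * h) - v) \<le> L * h"
  proof -
    have "norm (y (3 / 4 * h) - y 0) \<le> L * (3 / 4 * h)"
      using h by (intro vector_mean_value_bound[where f' = y1])
        (auto intro: has_vector_derivative_within_subset[OF derivs(1)] y_le)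
    also have "\<dots> \<le> L * h" using L0 h by (intro mult_left_mono) auto
    finally show ?thesis by (simp add: y0)
  qed
  have U_near: "norm (U - v) \<le> \<rho>"
  proof -
    have "h ^ 3 \<le> h" using power_decreasing[of 1 3 h] h by simp
    then have "?N * q * h ^ 3 \<le> ?N * q * h" using M0 q0 by (intro mult_left_mono) auto
    then show ?thesis
      using norm_triangle_ineq[of "U - y (3 / 4 * h)" "y (3 / 4 * h) - v"] U_err y_near
      by (simp add: \<rho>_def distrib_right)
  qed
  have "\<rho> < R" using small2 M0 q0 L0 by (simp add: \<rho>_def q_def)
  then have cballV: "cball v \<rho> \<subseteq> ?V" using ballV by (auto simp: subset_iff)
  have \<rho>0: "L * h \<le> \<rho>" "0 \<le> \<rho>" using M0 q0 L0 h by (auto simp: \<rho>_def intro!: mult_right_mono)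
  define \<delta> where "\<delta> = nonlin_rem g g1 v U - nonlin_rem g g1 v v"
  have \<delta>: "norm (\<delta> - f (3 / 4 * h)) \<le> (K * (L + ?N * q) * (?N * q)) * h ^ 4"
  proof -
    have "norm (nonlin_rem g g1 v U - nonlin_rem g g1 v (y (3 / 4 * h))) \<le> K * \<rho> * norm (U - y (3 / 4 * h))"
      using U_near y_near \<rho>0
      by (intro nonlin_rem_lipschitz[OF along cballV]) (auto simp: dist_norm norm_minus_commute)
    also have "\<dots> \<le> K * \<rho> * (?N * q * h ^ 3)"
      using K0 \<rho>0 by (intro mult_left_mono U_err) auto
    also have "\<dots> = (K * (L + ?N * q) * (?N * q)) * h ^ 4"
      by (simp add: \<rho>_def eval_nat_numeral)
    finally show ?thesis by (simp add: \<delta>_def f_eq b_def)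
  qed

  define a where "a = g2 v (y1 0) (y1 0)"
  define w where "w = g3 v (y1 0) (y1 0) (y1 0) + 3 *\<^sub>R g2 v (y1 0) (y2 0)"
  have taylor: "norm (f s - (s\<^sup>2 / 2) *\<^sub>R a - (s ^ 3 / 6) *\<^sub>R w) \<le> incr4_const K L * s ^ 4" if "s \<in> {0..h}" for s
    using incr_taylor[OF along that] by (simp only: f_def a_def w_def y0)
  have w: "w \<in> D" "norm (A w) \<le> B"
    using comp t h by (auto simp: compatibility_bound_def Let_def w_def v_def y1_def y2_def)
  have Jw: "norm (J w) \<le> B + K * (K * L * L * L + 3 * (K * L * L))"
  proof -
    have "norm w \<le> K * L * L * L + 3 * (K * L * L)"
      unfolding w_def
    proof (rule norm_triangle_mono)
      show "norm (g3 v (y1 0) (y1 0) (y1 0)) \<le> K * L * L * L"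
        by (intro norm_blinfun_le g_le y_le hI)
      have "norm (g2 v (y1 0) (y2 0)) \<le> K * L * L"
        by (intro norm_blinfun_le g_le y_le hI)
      then show "norm (3 *\<^sub>R g2 v (y1 0) (y2 0)) \<le> 3 * (K * L * L)" by simp
    qed
    then show ?thesis
      unfolding J_eq by (intro norm_triangle_mono w(2) norm_blinfun_le g_le)
  qed

  have "local_error c2 m \<beta> D A g g1 u t0 h n =
      y 0 + h *\<^sub>R phi_op 1 D J h (J (y 0) + b) + h *\<^sub>R ((32 / 9) *\<^sub>R phi_op 3 D J h \<delta>) - y h"
  proof -
    have "t0 + real (Suc n) * h = t + h" by (simp add: t_def algebra_simps)
    then show ?thesis
      by (simp only: local_error_def rosenbrock_step_def comb F_eq y_def t_def[symmetric] v_def[symmetric]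
          J_def[symmetric] U_def[symmetric] \<delta>_def[symmetric] y0 add_0_right)
  qed
  also have "norm \<dots> \<le> (?N * incr4_const K L + 5 / 4 * ?N * (B + K * (K * L * L * L + 3 * (K * L * L)))
      + 32 / 9 * ?N * (K * (L + ?N * q) * (?N * q) + incr4_const K L)) * h ^ 5"
    by (rule rosenbrock_step_error[OF J h(1) E_le yD y' p0 taylor w(1) Jw \<delta>])
  finally show ?thesis by (simp only: q_def)
qed

theorem lemma4p1:
  fixes c2 :: real and m :: nat and \<beta> :: "nat \<Rightarrow> real"
    and T M K L B R :: real
  assumes order_cond1: "\<forall>d. \<forall>Z \<in> carrier_mat d d.
      c2\<^sup>2 \<cdot>\<^sub>m phi_comb_mat m \<beta> Z = 2 \<cdot>\<^sub>m phi_mat 3 Z"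
    and order_cond2: "phi_comb m \<beta> (0::real) * c2 ^ 3 = 6 * phi 4 (0::real)"
    and strip_width: "0 < R"
  shows "\<exists>C h0. 0 < h0 \<and>
    (\<forall>(D :: 'a::banach set) A g g1 g2 g3 g4 t0 u0 u u1 u2 u3 u4.
       is_generator D A \<and>
       (SUP t\<in>{0..T}. norm (semigroup_of D A t)) \<le> M \<and>
       classical_solution D A g T t0 u0 u \<and>
       smooth_curve T L u u1 u2 u3 u4 \<and>
       smooth_nonlinearity (strip T R u) K g g1 g2 g3 g4 \<and>
       compatibility_bound D A g2 g3 t0 T B u u1 u2 \<longrightarrow>
       (\<forall>n h. 0 < h \<and> h \<le> h0 \<and> t0 + real (Suc n) * h \<le> T \<longrightarrow>
          norm (local_error c2 m \<beta> D A g g1 u t0 h n) \<le> C * h ^ 5))"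
proof -
  note c2 = order_conditions_node[OF order_cond1 order_cond2]
  note comb = order_conditions_coefficient[OF order_cond1 order_cond2]
  let ?k = "\<bar>M\<bar> * \<bar>K\<bar>" and ?l = "\<bar>L + 2 * M * incr2_const K L\<bar>"
  define h0 where "h0 = min 1 (min (1 / (2 * (?k + 1))) (R / (?l + 1)))"
  have h0: "0 < h0" using strip_width by (auto simp: h0_def add_nonneg_pos)
  have small: "h \<le> 1" "?k * h \<le> 1 / 2" "?l * h < R" if h: "0 < h" "h \<le> h0" for h
  proof -
    show "h \<le> 1" using h by (simp add: h0_def)
    have "h * (2 * (?k + 1)) \<le> 1"
      using h by (simp add: h0_def pos_le_divide_eq add_nonneg_pos)
    then show "?k * h \<le> 1 / 2" using h by (simp add: algebra_simps)
    have "h * (?l + 1) \<le> R"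
      using h by (simp add: h0_def pos_le_divide_eq add_nonneg_pos)
    then show "?l * h < R" using h by (simp add: algebra_simps)
  qed
  show ?thesis
    \<comment> \<open>The constant is the one of the preceding lemma, found by unification.\<close>
    by (rule exI, rule exI[of _ h0], intro conjI h0 allI impI,
        rule local_error_bound[OF _ _ _ _ _ _ strip_width _ _ _ _ _ c2 comb])
      (use small in blast)+
qed

end
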